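(* Let $r,u\ge 2$ be integers, $k=r(u-1)$, $q=(r-1)(u-1)$. Let $H$ be a connected $r$-regular $u$-uniform hypergraph of girth at least $3$, of diameter $d\ge 1$, with $n$ vertices. Let $\tau_2$ be the second eigenvalue of $H$, let $\lambda_i$ be the largest zero of $G_i^{(r,u)}(x)$ for $i\ge 1$, and $\lambda_0=-\infty$. (i) If $\tau_2\ge\lambda_d$, then $n\le G_d^{(r,u)}(k)-G_d^{(r,u)}(\tau_2)$, where $G_d^{(r,u)}(\tau_2)\ge 0$. (ii) If $\lambda_{d-1}<\tau_2<\lambda_d$, then $$n\le 1+\sum_{j=0}^{d-2}kq^j+\frac{kq^{d-1}}{c}\le G_d^{(r,u)}(k)+G_d^{(r,u)}(\tau_2),$$ where $c=-F_d^{(r,u)}(\tau_2)/G_{d-1}^{(r,u)}(\tau_2)$ and $G_d^{(r,u)}(\tau_2)<0$. (iii) If $\tau_2\le\lambda_{d-1}$, then $n\le 1+\sum_{j=0}^{d-2}kq^j$. Moreover, if $\lambda_{d-1}<\tau_2<\lambda_d$ and $q\ge 6$, then $1+\sum_{j=0}^{d-2}kq^j+\frac{kq^{d-1}}{c}<G_d^{(r,u)}(k)+G_d^{(r,u)}(\tau_2)$ (with $c$ as in (ii)).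
   Context: A hypergraph $H=(V,E)$ consists of a finite vertex set $V$ and a set $E$ of subsets of $V$ (edges), each of size at least 2 (no repeated edges). It is $u$-uniform if every edge has exactly $u$ vertices and $r$-regular if every vertex is in exactly $r$ edges. A walk of length $p$ from $x_0$ to $x_p$ is a sequence $(x_0,e_1,x_1,\ldots,e_p,x_p)$ of vertices and edges with $x_{i-1},x_i\in e_i$, $x_{i-1}\ne x_i$; $H$ is connected if any two vertices are joined by a walk, the distance between two vertices is the minimum length of a walk between them, and the diameter is the maximum distance. The girth is the minimum length of a Berge cycle (a walk with $x_0=x_p$ with all edges distinct and all vertices distinct except $x_0=x_p$); girth at least 3 implies any two distinct vertices lie in at most one common edge. The adjacency matrix has entries $A_{xy}=|\{e\in E:\{x,y\}\subset e\}|$ for $x\neq y$ and $A_{xx}=0$; the eigenvalues of $H$ are those of $A$, and the second eigenvalue is the second largest one (with multiplicity). Polynomials: $F_0^{(r,u)}=1$, $F_1^{(r,u)}=x$, $F_2^{(r,u)}=x^2-(u-2)x-r(u-1)$, $F_{i+1}^{(r,u)}(x)=(x-u+2)F_i^{(r,u)}(x)-(r-1)(u-1)F_{i-1}^{(r,u)}(x)$ for $i\ge 2$; $G_i^{(r,u)}(x)=\sum_{j=0}^i F_j^{(r,u)}(x)$. *)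

theory Defs
  imports
    "Jordan_Normal_Form.Char_Poly"
    "HOL-Library.Extended_Nat"
    "HOL-Library.Extended_Real"
begin

definition hypergraph :: "'a set \<Rightarrow> 'a set set \<Rightarrow> bool" where
  "hypergraph V E \<longleftrightarrow> finite V \<and> (\<forall>e\<in>E. e \<subseteq> V \<and> 2 \<le> card e)"

definition uniform :: "'a set set \<Rightarrow> nat \<Rightarrow> bool" where
  "uniform E u \<longleftrightarrow> (\<forall>e\<in>E. card e = u)"

definition regular :: "'a set \<Rightarrow> 'a set set \<Rightarrow> nat \<Rightarrow> bool" where
  "regular V E r \<longleftrightarrow> (\<forall>x\<in>V. card {e \<in> E. x \<in> e} = r)"

text \<open>
  The walk \<open>(x\<^sub>0, e\<^sub>1, x\<^sub>1, \<dots>, e\<^sub>p, x\<^sub>p)\<close> is given by its vertices \<open>xs = [x\<^sub>0, \<dots>, x\<^sub>p]\<close> and its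
  edges \<open>es = [e\<^sub>1, \<dots>, e\<^sub>p]\<close>, so that the edge \<open>es ! i\<close> joins \<open>xs ! i\<close> to \<open>xs ! Suc i\<close>.
  Its length is \<open>length es\<close>.
\<close>

definition walk :: "'a set \<Rightarrow> 'a set set \<Rightarrow> 'a list \<Rightarrow> 'a set list \<Rightarrow> bool" where
  "walk V E xs es \<longleftrightarrow>
     length xs = Suc (length es) \<and> set xs \<subseteq> V \<and> set es \<subseteq> E \<and>
     (\<forall>i < length es. xs ! i \<in> es ! i \<and> xs ! Suc i \<in> es ! i \<and> xs ! i \<noteq> xs ! Suc i)"

definition walk_betw :: "'a set \<Rightarrow> 'a set set \<Rightarrow> 'a \<Rightarrow> 'a \<Rightarrow> nat \<Rightarrow> bool" where
  "walk_betw V E x y p \<longleftrightarrow>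
     (\<exists>xs es. walk V E xs es \<and> hd xs = x \<and> last xs = y \<and> length es = p)"

definition connected_hypergraph :: "'a set \<Rightarrow> 'a set set \<Rightarrow> bool" where
  "connected_hypergraph V E \<longleftrightarrow> (\<forall>x\<in>V. \<forall>y\<in>V. \<exists>p. walk_betw V E x y p)"

text \<open>The distance is infinite when there is no walk.\<close>

definition distance :: "'a set \<Rightarrow> 'a set set \<Rightarrow> 'a \<Rightarrow> 'a \<Rightarrow> enat" where
  "distance V E x y = Inf {enat p | p. walk_betw V E x y p}"

definition diameter :: "'a set \<Rightarrow> 'a set set \<Rightarrow> enat" where
  "diameter V E = Sup {distance V E x y | x y. x \<in> V \<and> y \<in> V}"

text \<open>
  A Berge cycle has positive length; since consecutive vertices of a walk differ, its length is
  then at least 2. The girth is infinite when there is no Berge cycle.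
\<close>

definition berge_cycle :: "'a set \<Rightarrow> 'a set set \<Rightarrow> 'a list \<Rightarrow> 'a set list \<Rightarrow> bool" where
  "berge_cycle V E xs es \<longleftrightarrow>
     walk V E xs es \<and> es \<noteq> [] \<and> hd xs = last xs \<and> distinct es \<and> distinct (butlast xs)"

definition girth :: "'a set \<Rightarrow> 'a set set \<Rightarrow> enat" where
  "girth V E = Inf {enat (length es) | xs es. berge_cycle V E xs es}"

definition adjacency :: "'a set set \<Rightarrow> 'a \<Rightarrow> 'a \<Rightarrow> real" where
  "adjacency E x y = (if x = y then 0 else real (card {e \<in> E. {x, y} \<subseteq> e}))"

text \<open>
  Library matrices are indexed by \<open>{0..<n}\<close>, so the vertices are listed in some order. A different
  order conjugates the matrix by a permutation matrix and leaves its eigenvalues unchanged.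
\<close>

definition vertex_list :: "'a set \<Rightarrow> 'a list" where
  "vertex_list V = (SOME xs. distinct xs \<and> set xs = V)"

definition adjacency_matrix :: "'a set \<Rightarrow> 'a set set \<Rightarrow> real mat" where
  "adjacency_matrix V E =
     mat (card V) (card V) (\<lambda>(i, j). adjacency E (vertex_list V ! i) (vertex_list V ! j))"

text \<open>
  The adjacency matrix is real symmetric, so all the roots of its characteristic polynomial are
  real.
\<close>

definition eigenvalues_mset :: "'a set \<Rightarrow> 'a set set \<Rightarrow> real multiset" where
  "eigenvalues_mset V E = proots (char_poly (adjacency_matrix V E))"

text \<open>
  The second entry of the eigenvalues in decreasing order, with multiplicity. This is meaningful
  only for hypergraphs with at least two vertices.
\<close>

definition second_eigenvalue :: "'a set \<Rightarrow> 'a set set \<Rightarrow> real" where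
  "second_eigenvalue V E = rev (sorted_list_of_multiset (eigenvalues_mset V E)) ! 1"

fun F :: "nat \<Rightarrow> nat \<Rightarrow> nat \<Rightarrow> real poly" where
  "F r u 0 = 1"
| "F r u (Suc 0) = [:0, 1:]"
| "F r u (Suc (Suc 0)) =
     [:0, 1:] ^ 2 - [:real u - 2:] * [:0, 1:] - [:real r * (real u - 1):]"
| "F r u (Suc (Suc (Suc i))) =
     ([:0, 1:] - [:real u - 2:]) * F r u (Suc (Suc i))
       - [:(real r - 1) * (real u - 1):] * F r u (Suc i)"

definition G :: "nat \<Rightarrow> nat \<Rightarrow> nat \<Rightarrow> real poly" where
  "G r u i = (\<Sum>j\<le>i. F r u j)"

definition largest_zero :: "real poly \<Rightarrow> real" where
  "largest_zero p = Max {x. poly p x = 0}"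

definition lam :: "nat \<Rightarrow> nat \<Rightarrow> nat \<Rightarrow> ereal" where
  "lam r u i = (if i = 0 then - \<infinity> else ereal (largest_zero (G r u i)))"

end

theory Submission
  imports "HOL-Analysis.Function_Topology" Defs
begin

text \<open>
  With \<open>A\<close> the adjacency matrix, \<open>F\<^sub>i(A)\<close> counts the walks of length \<open>i\<close> in which consecutive edges
  differ. So \<open>F\<^sub>i(A)\<close> is nonnegative, has row sums \<open>F\<^sub>i(k)\<close>, and \<open>G\<^sub>d(A)\<close> is at least the all-ones matrix
  \<open>J\<close>. The eigenvalue \<open>G\<^sub>d(\<tau>)\<close> of the nonnegative matrix \<open>G\<^sub>d(A) - J\<close> is at most its row sum
  \<open>G\<^sub>d(k) - n\<close> in absolute value, which is (i).

  For (ii) and (iii), let \<open>\<sigma> \<ge> \<tau>\<close> be a zero of \<open>g = G\<^sub>m + a G\<^sub>m\<^sub>-\<^sub>1\<close>, \<open>a \<ge> 0\<close>, beyond the largest zero of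
  \<open>G\<^sub>m\<^sub>-\<^sub>1\<close>. By Christoffel--Darboux \<open>h = g / (x - \<sigma>)\<close> is a positive combination of the \<open>G\<^sub>j\<close>, and \<open>g h\<close> is
  nonpositive on all eigenvalues other than the trivial \<open>k\<close>; linear programming gives
  \<open>n \<le> g(k) / (1 + a)\<close>. Take \<open>m = d\<close>, \<open>\<sigma> = \<tau>\<close>, \<open>a = c - 1\<close> for (ii), and \<open>m = d - 1\<close>, \<open>a = 0\<close>,
  \<open>\<sigma> = \<lambda>\<^sub>m\<close> for (iii). The two bounds in (ii) compare like \<open>- F\<^sub>d(\<tau>)\<close> and \<open>F\<^sub>d(k)\<close>.
\<close>

section \<open>The orthogonal polynomials\<close>

locale degree_uniformity =
  fixes r u :: nat
  assumes r_ge_2: "2 \<le> r" and u_ge_2: "2 \<le> u"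
begin

definition k :: real where "k = real r * (real u - 1)"
definition q :: real where "q = (real r - 1) * (real u - 1)"

lemma q_ge: "real u - 1 \<le> q" "1 \<le> q"
proof -
  have "1 * (real u - 1) \<le> q"
    unfolding q_def using r_ge_2 u_ge_2 by (intro mult_right_mono) auto
  then show "real u - 1 \<le> q" "1 \<le> q"
    using u_ge_2 by simp_all
qed

lemma k_eq: "k = q + (real u - 1)"
  by (simp add: k_def q_def algebra_simps)

section \<open>Recurrences, and values at the trivial eigenvalue \<open>k\<close>\<close>

lemma F_Suc_Suc_Suc:
  "poly (F r u (Suc (Suc (Suc i)))) x
    = (x - (real u - 2)) * poly (F r u (Suc (Suc i))) x - q * poly (F r u (Suc i)) x"
  by (simp add: q_def algebra_simps del: F.simps(3))

lemma F_2: "poly (F r u (Suc (Suc 0))) x = x * x - (real u - 2) * x - k"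
  by (simp add: k_def power2_eq_square algebra_simps)

lemma F_at_k: "poly (F r u (Suc i)) k = k * q ^ i"
proof (induction i rule: less_induct)
  case (less i)
  consider "i = 0" | "i = Suc 0" | j where "i = Suc (Suc j)"
    by (metis not0_implies_Suc)
  then show ?case
  proof cases
    case 2
    then show ?thesis by (simp add: F_2 k_eq algebra_simps del: F.simps(3))
  next
    case 3
    have "poly (F r u (Suc i)) k = (k - (real u - 2)) * (k * q ^ Suc j) - q * (k * q ^ j)"
      using less[of j] less[of "Suc j"] 3 by (simp only: F_Suc_Suc_Suc)
    also have "\<dots> = k * q ^ i"
      by (simp add: 3 k_eq algebra_simps)
    finally show ?thesis .
  qed simp
qed

lemma G_at_k: "poly (G r u d) k = 1 + (\<Sum>j<d. k * q ^ j)"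
  by (simp add: G_def poly_sum sum.atMost_shift F_at_k)

lemma G_0: "poly (G r u 0) x = 1"
  by (simp add: G_def)

lemma G_1: "poly (G r u (Suc 0)) x = x + 1"
  by (simp add: G_def)

lemma G_Suc: "poly (G r u (Suc i)) x = poly (G r u i) x + poly (F r u (Suc i)) x"
  by (simp add: G_def)

text \<open>Summation absorbs the exceptional coefficient \<open>k = q + (u - 1)\<close> of
  \<open>F_2\<close>, so the \<open>G_i\<close> obey a single three-term recurrence from the start.
  This is why zeros and signs are studied for \<open>G\<close> rather than \<open>F\<close>.\<close>

lemma G_Suc_Suc:
  "poly (G r u (Suc (Suc i))) x
    = (x - (real u - 2)) * poly (G r u (Suc i)) x - q * poly (G r u i) x"
proof (induction i)
  case 0
  then show ?case by (simp add: G_def q_def power2_eq_square algebra_simps)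
next
  case (Suc i)
  show ?case
    using Suc F_Suc_Suc_Suc[of i x] G_Suc[of "Suc (Suc i)" x] G_Suc[of "Suc i" x] G_Suc[of i x]
    by (simp add: algebra_simps del: F.simps)
qed

text \<open>In the antisymmetric left side the shift \<open>u - 2\<close> cancels and each step
  multiplies the previous difference by \<open>q\<close>, whence the weights
  \<open>q ^ (i - j)\<close>.\<close>

lemma christoffel_darboux:
  "poly (G r u (Suc i)) x * poly (G r u i) y - poly (G r u i) x * poly (G r u (Suc i)) y
    = (x - y) * (\<Sum>j\<le>i. q ^ (i - j) * poly (G r u j) x * poly (G r u j) y)"
proof (induction i)
  case 0
  then show ?case by (simp add: G_0 G_1)
next
  case (Suc i)
  have "(\<Sum>j\<le>Suc i. q ^ (Suc i - j) * poly (G r u j) x * poly (G r u j) y)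
    = q * (\<Sum>j\<le>i. q ^ (i - j) * poly (G r u j) x * poly (G r u j) y)
      + poly (G r u (Suc i)) x * poly (G r u (Suc i)) y"
    by (simp add: sum_distrib_left Suc_diff_le mult_ac)
  then have "(x - y) * (\<Sum>j\<le>Suc i. q ^ (Suc i - j) * poly (G r u j) x * poly (G r u j) y)
    = q * (poly (G r u (Suc i)) x * poly (G r u i) y - poly (G r u i) x * poly (G r u (Suc i)) y)
      + (x - y) * (poly (G r u (Suc i)) x * poly (G r u (Suc i)) y)"
    unfolding Suc.IH by (simp add: distrib_left mult.left_commute)
  then show ?case
    unfolding G_Suc_Suc by (simp add: algebra_simps)
qed

text \<open>The ratio of consecutive values stays at least \<open>sqrt q\<close>: the factor of
  \<open>G_(i+1)\<close> is at least \<open>2 * sqrt q\<close>, and subtracting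
  \<open>q * G_i\<close> costs at most one \<open>sqrt q\<close> of it.\<close>

lemma G_pos_right:
  assumes "real u - 2 + 2 * sqrt q \<le> x"
  shows "0 < poly (G r u i) x"
proof -
  define s where "s = sqrt q"
  have s: "0 < s" "s * s = q" using q_ge by (auto simp: s_def)
  have "0 < poly (G r u i) x \<and> s * poly (G r u i) x \<le> poly (G r u (Suc i)) x"
  proof (induction i)
    case 0
    have "real u - 2 + 2 * s \<le> x" "2 \<le> real u" using assms u_ge_2 by (simp_all add: s_def)
    then show ?case using s by (simp add: G_0 G_1)
  next
    case (Suc i)
    let ?a = "poly (G r u i) x" and ?b = "poly (G r u (Suc i)) x"
    have b: "0 < ?b" using Suc s by (meson less_le_trans mult_pos_pos)
    have "2 * s * ?b \<le> (x - (real u - 2)) * ?b"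
      using assms b by (intro mult_right_mono) (auto simp: s_def)
    moreover have "q * ?a \<le> s * ?b"
      using Suc s by (simp add: mult.assoc flip: s(2))
    ultimately have "s * ?b \<le> (x - (real u - 2)) * ?b - q * ?a" by linarith
    with b show ?case unfolding G_Suc_Suc by simp
  qed
  then show ?thesis by simp
qed

lemma G_nonzero: "G r u i \<noteq> 0"
  using G_pos_right[of "real u - 2 + 2 * sqrt q" i] by auto

text \<open>
  At the largest zero of \<open>G\<^sub>i\<^sub>+\<^sub>1\<close> the recurrence gives \<open>G\<^sub>i\<^sub>+\<^sub>2 = - q G\<^sub>i < 0\<close>, so
  \<open>G\<^sub>i\<^sub>+\<^sub>2\<close> has a zero further to the right.
\<close>

lemma largest_zero_G:
  "poly (G r u (Suc i)) (largest_zero (G r u (Suc i))) = 0 \<and>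
   (\<forall>j\<le>i. 0 < poly (G r u j) (largest_zero (G r u (Suc i)))) \<and>
   (\<forall>x>largest_zero (G r u (Suc i)). \<forall>j\<le>Suc i. 0 < poly (G r u j) x)"
proof (induction i)
  case 0
  have "{x. poly (G r u (Suc 0)) x = 0} = {-1}" by (auto simp: G_1)
  then have "largest_zero (G r u (Suc 0)) = -1" by (simp add: largest_zero_def)
  then show ?case by (auto simp: G_0 G_1 le_Suc_eq)
next
  case (Suc i)
  define l where "l = largest_zero (G r u (Suc i))"
  define l' where "l' = largest_zero (G r u (Suc (Suc i)))"
  \<comment> \<open>Every \<open>G_j\<close> is positive from \<open>B\<close> on, so
    \<open>B\<close> serves as right endpoint for the intermediate value theorem.\<close>
  define B where "B = real u - 2 + 2 * sqrt q"
  let ?p = "G r u (Suc (Suc i))"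
  have l: "poly (G r u (Suc i)) l = 0" "0 < poly (G r u i) l" "\<And>x j. l < x \<Longrightarrow> j \<le> Suc i \<Longrightarrow> 0 < poly (G r u j) x"
    using Suc by (auto simp: l_def)
  have B: "B \<le> x \<Longrightarrow> 0 < poly (G r u j) x" for j x
    by (simp add: B_def G_pos_right)
  have "l < B" using B[of l "Suc i"] l(1) by (cases "l < B") auto
  moreover have "poly ?p l < 0"
    using l q_ge by (simp add: G_Suc_Suc)
  moreover have "0 < poly ?p B" by (rule B) simp
  ultimately obtain z where z: "l < z" "poly ?p z = 0"
    using poly_IVT_pos[of l B ?p] by auto
  have fin: "finite {x. poly ?p x = 0}" by (intro poly_roots_finite G_nonzero)
  have l'_eq: "l' = Max {x. poly ?p x = 0}" by (simp add: l'_def largest_zero_def)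
  have root: "poly ?p l' = 0" using Max_in[OF fin] z by (auto simp: l'_eq)
  have max: "x \<le> l'" if "poly ?p x = 0" for x
    using fin that by (simp add: l'_eq)
  have "l < l'" using max[OF z(2)] z(1) by simp
  have "0 < poly ?p x" if "l' < x" for x
  proof (rule ccontr)
    assume neg: "\<not> 0 < poly ?p x"
    then have "x < B" using B[of x] by force
    moreover have "poly ?p x < 0" using neg max[of x] that by force
    ultimately obtain y where "x < y" "poly ?p y = 0"
      using poly_IVT_pos[of x B ?p] B[of B] by auto
    then show False using max[of y] that by simp
  qed
  with root l \<open>l < l'\<close> show ?case
    unfolding l'_def[symmetric] by (auto simp: le_Suc_eq dest: less_trans)
qed

section \<open>Signs of \<open>G\<close> relative to \<open>lam\<close>\<close>

lemma G_pos_of_lam: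
  assumes "lam r u i < ereal x" "j \<le> i"
  shows "0 < poly (G r u j) x"
  using assms largest_zero_G[of "i - 1"] by (cases i) (auto simp: lam_def G_0)

lemma G_nonneg_of_lam:
  assumes "lam r u i \<le> ereal x"
  shows "0 \<le> poly (G r u i) x"
  using assms largest_zero_G[of "i - 1"] by (cases i) (auto simp: lam_def G_0 le_less)

lemma lam_less:
  assumes "ereal x < lam r u (Suc i)"
  shows "x < real u - 2 + 2 * sqrt q"
  using assms largest_zero_G[of i] G_pos_right[of "largest_zero (G r u (Suc i))" "Suc i"]
  by (fastforce simp: lam_def)

text \<open>Christoffel-Darboux with second argument the largest zero \<open>l\<close> of
  \<open>G_(i+1)\<close>: only \<open>G_(i+1)(x) * G_i(l)\<close> survives on the left, while the
  sum on the right is positive and \<open>x < l\<close>.\<close>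

lemma G_neg_between:
  assumes "lam r u i < ereal x" "ereal x < lam r u (Suc i)"
  shows "poly (G r u (Suc i)) x < 0"
proof -
  define l where "l = largest_zero (G r u (Suc i))"
  have l: "poly (G r u (Suc i)) l = 0" "\<And>j. j \<le> i \<Longrightarrow> 0 < poly (G r u j) l" "x < l"
    using largest_zero_G[of i] assms by (auto simp: l_def lam_def)
  have "0 < (\<Sum>j\<le>i. q ^ (i - j) * poly (G r u j) x * poly (G r u j) l)"
    using l G_pos_of_lam[OF assms(1)] q_ge by (intro sum_pos) auto
  then have "(x - l) * (\<Sum>j\<le>i. q ^ (i - j) * poly (G r u j) x * poly (G r u j) l) < 0"
    using l by (intro mult_neg_pos) auto
  then have "poly (G r u (Suc i)) x * poly (G r u i) l < 0"
    unfolding christoffel_darboux[symmetric] using l by simp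
  then show ?thesis using l(2)[of i] by (simp add: mult_less_0_iff)
qed

text \<open>
  \<open>chebyshev y i\<close> is \<open>q\<^sup>i\<^sup>/\<^sup>2 U\<^sub>i(y / (2 \<surd>q))\<close> with \<open>U\<^sub>i\<close> the Chebyshev polynomial of the second
  kind.
\<close>

fun chebyshev :: "real \<Rightarrow> nat \<Rightarrow> real" where
  "chebyshev y 0 = 1"
| "chebyshev y (Suc 0) = y"
| "chebyshev y (Suc (Suc i)) = y * chebyshev y (Suc i) - q * chebyshev y i"

text \<open>The recurrence multiplies this quadratic form by \<open>q\<close> at each step. For
  \<open>y\<^sup>2 \<le> 4 * q\<close> the form is positive semidefinite and so controls the size of
  the sequence.\<close>

lemma chebyshev_invariant:
  "(chebyshev y (Suc i))\<^sup>2 - y * chebyshev y i * chebyshev y (Suc i) + q * (chebyshev y i)\<^sup>2 = q ^ Suc i"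
proof (induction i)
  case 0
  then show ?case by (simp add: power2_eq_square)
next
  case (Suc i)
  have "(chebyshev y (Suc (Suc i)))\<^sup>2 - y * chebyshev y (Suc i) * chebyshev y (Suc (Suc i)) + q * (chebyshev y (Suc i))\<^sup>2
    = q * ((chebyshev y (Suc i))\<^sup>2 - y * chebyshev y i * chebyshev y (Suc i) + q * (chebyshev y i)\<^sup>2)"
    by (simp add: power2_eq_square algebra_simps)
  then show ?case unfolding Suc.IH by simp
qed

text \<open>Completing the square in the invariant shows that each term differs from
  \<open>y / 2\<close> times its predecessor by at most a power of \<open>sqrt q\<close>. Induction
  then gives the classical bound \<open>i + 1\<close> for Chebyshev polynomials on
  \<open>[-1, 1]\<close>.\<close>

lemma abs_chebyshev_le:
  assumes "\<bar>y\<bar> \<le> 2 * sqrt q"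
  shows "\<bar>chebyshev y i\<bar> \<le> (real i + 1) * sqrt q ^ i"
proof (induction i)
  case 0
  then show ?case by simp
next
  case (Suc i)
  let ?a = "chebyshev y i" and ?b = "chebyshev y (Suc i)"
  have q0: "0 \<le> q" using q_ge by simp
  have "y\<^sup>2 \<le> (2 * sqrt q)\<^sup>2" using assms by (metis abs_ge_zero power2_abs power_mono)
  then have "0 \<le> (q - (y / 2)\<^sup>2) * ?a\<^sup>2" using q0 by (simp add: power_divide power_mult_distrib)
  moreover have "(?b - y / 2 * ?a)\<^sup>2 = q ^ Suc i - (q - (y / 2)\<^sup>2) * ?a\<^sup>2"
    unfolding chebyshev_invariant[of y i, symmetric] by (simp add: power2_eq_square algebra_simps)
  moreover have "q ^ Suc i = (sqrt q ^ Suc i)\<^sup>2"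
    using q0 by (simp only: power2_eq_square power_mult_distrib[symmetric]) simp
  ultimately have "(?b - y / 2 * ?a)\<^sup>2 \<le> (sqrt q ^ Suc i)\<^sup>2"
    by linarith
  then have "\<bar>?b - y / 2 * ?a\<bar> \<le> sqrt q ^ Suc i"
    using q0 by (simp add: abs_le_square_iff[symmetric] del: power_Suc)
  moreover have "\<bar>y / 2 * ?a\<bar> \<le> sqrt q * ((real i + 1) * sqrt q ^ i)"
    unfolding abs_mult using assms Suc q0 by (intro mult_mono) auto
  ultimately have "\<bar>?b\<bar> \<le> sqrt q ^ Suc i + sqrt q * ((real i + 1) * sqrt q ^ i)" by linarith
  then show ?case by (simp add: algebra_simps)
qed

lemma F_chebyshev:
  "poly (F r u (Suc (Suc i))) x = chebyshev (x - (real u - 2)) (Suc (Suc i))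
    + (real u - 2) * chebyshev (x - (real u - 2)) (Suc i) - (real u - 1) * chebyshev (x - (real u - 2)) i"
proof (induction i rule: less_induct)
  case (less i)
  \<comment> \<open>The recurrence for \<open>F_3\<close> refers to \<open>F_1\<close>, which the
    formula does not cover, so both \<open>F_2\<close> and \<open>F_3\<close> are base
    cases.\<close>
  consider "i = 0" | "i = Suc 0" | j where "i = Suc (Suc j)"
    by (metis not0_implies_Suc)
  then show ?case
  proof cases
    case 1
    then show ?thesis by (simp add: F_2 k_eq algebra_simps del: F.simps(3))
  next
    case 2
    then show ?thesis by (simp only: F_Suc_Suc_Suc F_2) (simp add: k_eq algebra_simps)
  next
    case 3
    define y where "y = x - (real u - 2)"
    have f4: "poly (F r u (Suc (Suc i))) x = y * poly (F r u (Suc (Suc (Suc j)))) x - q * poly (F r u (Suc (Suc j))) x"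
      unfolding 3 y_def by (rule F_Suc_Suc_Suc)
    have f2: "poly (F r u (Suc (Suc j))) x
        = chebyshev y (Suc (Suc j)) + (real u - 2) * chebyshev y (Suc j) - (real u - 1) * chebyshev y j"
      using less[of j] by (simp only: 3 y_def)
    have f3: "poly (F r u (Suc (Suc (Suc j)))) x
        = chebyshev y (Suc (Suc (Suc j))) + (real u - 2) * chebyshev y (Suc (Suc j)) - (real u - 1) * chebyshev y (Suc j)"
      using less[of "Suc j"] by (simp only: 3 y_def)
    show ?thesis
      unfolding y_def[symmetric] f4 f3 f2 unfolding 3 chebyshev.simps by (simp add: algebra_simps)
  qed
qed

text \<open>The left side is the Chebyshev estimate for \<open>- F_(i+2)\<close> divided by
  \<open>sqrt q ^ i\<close>. It is affine in \<open>i\<close> and at most doubles from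
  \<open>i\<close> to \<open>i + 1\<close>, while the right side gains the factor
  \<open>sqrt q \<ge> 2\<close>.\<close>

lemma growth_bound:
  assumes "4 \<le> q"
  shows "(real i + 3) * q + (real u - 2) * (real i + 2) * sqrt q + (real u - 1) * (real i + 1)
    < k * sqrt q ^ (i + 2)"
proof -
  define s where "s = sqrt q"
  define L where "L = (\<lambda>i. (real i + 3) * q + (real u - 2) * (real i + 2) * s + (real u - 1) * (real i + 1))"
  have s2: "s * s = q" using assms by (simp add: s_def)
  have s: "2 \<le> s" using assms by (simp add: s_def real_le_rsqrt)
  have "L i < k * s ^ (i + 2)"
  proof (induction i)
    case 0
    have "2 * s \<le> s * s" using s by (intro mult_right_mono) auto
    then have "(real u - 2) * (2 * s) \<le> (real u - 2) * q"
      using u_ge_2 s2 by (intro mult_left_mono) auto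
    moreover have "4 * q \<le> q * q" using assms by (intro mult_right_mono) auto
    moreover have "L 0 = 3 * q + (real u - 2) * (2 * s) + (real u - 1)"
      by (simp add: L_def)
    moreover have "k * q = q * q + (real u - 2) * q + q"
      by (simp add: k_eq algebra_simps)
    ultimately have "L 0 < k * q"
      using q_ge assms by linarith
    then show ?case by (simp add: power2_eq_square s2)
  next
    case (Suc i)
    define D where "D = q + (real u - 2) * s + (real u - 1)"
    have "0 \<le> D" using s u_ge_2 assms by (simp add: D_def)
    have "L (Suc i) = L i + D" by (simp add: L_def D_def algebra_simps)
    moreover have "L i = D + ((real i + 2) * q + (real u - 2) * (real i + 1) * s + (real u - 1) * real i)"
      by (simp add: L_def D_def algebra_simps)
    moreover have "0 \<le> (real i + 2) * q + (real u - 2) * (real i + 1) * s + (real u - 1) * real i"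
      using s u_ge_2 assms by simp
    ultimately have "L (Suc i) \<le> 2 * L i" "0 \<le> L i" using \<open>0 \<le> D\<close> by linarith+
    moreover have "2 * L i \<le> s * L i" using s \<open>0 \<le> L i\<close> by (rule mult_right_mono)
    ultimately have "L (Suc i) \<le> s * L i" by linarith
    also have "\<dots> < s * (k * s ^ (i + 2))" using Suc s by (intro mult_strict_left_mono) auto
    finally show ?case by (simp add: mult_ac)
  qed
  then show ?thesis by (simp add: L_def s_def)
qed

text \<open>For \<open>d \<ge> 2\<close>, with \<open>d = i + 2\<close>, the strict comparison in
  the last claim reduces to this inequality.\<close>

lemma minus_F_less:
  assumes q: "4 \<le> q" and lam: "lam r u (Suc i) < ereal x" "ereal x < lam r u (Suc (Suc i))"
  shows "- poly (F r u (Suc (Suc i))) x < k * q ^ Suc i"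
proof (cases i)
  case 0
  \<comment> \<open>Completing the square in the quadratic \<open>F_2\<close> bounds
    \<open>- F_2(x)\<close> by \<open>k + (u - 2)\<^sup>2 / 4\<close>.\<close>
  have "(real u - 2)\<^sup>2 / 4 \<le> q * (q - 1) / 4"
    unfolding power2_eq_square using q_ge u_ge_2 by (intro divide_right_mono mult_mono) auto
  also have "\<dots> < q * (q - 1)" using q by auto
  also have "\<dots> \<le> k * (q - 1)" using q u_ge_2 by (intro mult_right_mono) (auto simp: k_eq)
  finally have "(real u - 2)\<^sup>2 / 4 < k * (q - 1)" .
  moreover have "0 \<le> (x - (real u - 2) / 2)\<^sup>2" by simp
  ultimately show ?thesis using 0 by (simp add: k_def power2_eq_square field_simps)
next
  case (Suc m)
  define y where "y = x - (real u - 2)"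
  define s where "s = sqrt q"
  have s2: "s * s = q" "0 \<le> s" "0 < s" using q by (auto simp: s_def)
  \<comment> \<open>These are \<open>G_2(x)\<close> and \<open>G_1(x)\<close>. Their positivity
    forces \<open>y > 0\<close>, the lower half of the range needed for the Chebyshev
    estimate.\<close>
  have "0 < y * (x + 1) - q" "0 < x + 1"
    using G_pos_of_lam[OF lam(1), of "Suc (Suc 0)"] G_pos_of_lam[OF lam(1), of "Suc 0"] Suc
    by (simp_all add: G_Suc_Suc G_0 G_1 y_def)
  then have "0 < y" using q by (smt (verit) zero_less_mult_pos2)
  moreover have "y < 2 * s" using lam_less[OF lam(2)] by (simp add: y_def s_def)
  ultimately have y: "\<bar>y\<bar> \<le> 2 * sqrt q" by (simp add: s_def)
  note bound = abs_chebyshev_le[OF y, folded s_def]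
  have "- poly (F r u (Suc (Suc i))) x \<le> \<bar>chebyshev y (Suc (Suc i))\<bar> + (real u - 2) * \<bar>chebyshev y (Suc i)\<bar>
     + (real u - 1) * \<bar>chebyshev y i\<bar>"
  proof -
    have "- t * c \<le> t * \<bar>c\<bar>" "t * c \<le> t * \<bar>c\<bar>" if "0 \<le> t" for t c :: real
      using mult_left_mono[of "-c" "\<bar>c\<bar>" t] mult_left_mono[of c "\<bar>c\<bar>" t] that by auto
    from this(1)[of "real u - 2" "chebyshev y (Suc i)"] this(2)[of "real u - 1" "chebyshev y i"]
    show ?thesis using u_ge_2 unfolding F_chebyshev y_def[symmetric] by linarith
  qed
  also have "\<dots> \<le> (real (Suc (Suc i)) + 1) * s ^ Suc (Suc i) + (real u - 2) * ((real (Suc i) + 1) * s ^ Suc i)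
     + (real u - 1) * ((real i + 1) * s ^ i)"
    using u_ge_2 by (intro add_mono mult_left_mono bound) auto
  also have "\<dots> = s ^ i * ((real i + 3) * q + (real u - 2) * (real i + 2) * s + (real u - 1) * (real i + 1))"
    by (simp add: s2(1)[symmetric] algebra_simps)
  also have "\<dots> < s ^ i * (k * s ^ (i + 2))"
    using growth_bound[OF q, of i] s2 by (intro mult_strict_left_mono) (auto simp: s_def)
  also have "\<dots> = k * q ^ Suc i"
    by (simp add: s2(1)[symmetric] power_mult_distrib mult_ac)
  finally show ?thesis .
qed

end

section \<open>Nonbacktracking walks\<close>

text \<open>
  \<open>nb E x i z e\<close> is the number of nonbacktracking walks of length \<open>i\<close> from \<open>x\<close> to \<open>z\<close> whose last edge
  is not \<open>e\<close>. Taking \<open>e = {}\<close>, which is never an edge, drops the condition on the last edge.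
\<close>

fun nb :: "'a set set \<Rightarrow> 'a \<Rightarrow> nat \<Rightarrow> 'a \<Rightarrow> 'a set \<Rightarrow> nat" where
  "nb E x 0 z e = of_bool (z = x)"
| "nb E x (Suc i) z e = (\<Sum>e'\<in>{e'\<in>E. z \<in> e' \<and> e' \<noteq> e}. \<Sum>y\<in>e' - {z}. nb E x i y e')"

text \<open>The adjacency operator, summed edge by edge so that it matches the recursion of
  \<open>nb\<close>; \<open>adj_adjacency\<close> identifies it with the matrix.\<close>

definition adj :: "'a set set \<Rightarrow> ('a \<Rightarrow> real) \<Rightarrow> 'a \<Rightarrow> real" where
  "adj E f y = (\<Sum>e\<in>{e\<in>E. y \<in> e}. \<Sum>z\<in>e - {y}. f z)"

definition nbw :: "'a set set \<Rightarrow> 'a \<Rightarrow> nat \<Rightarrow> 'a \<Rightarrow> real" where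
  "nbw E x i z = real (nb E x i z {})"

locale regular_uniform_hypergraph =
  degree_uniformity r u for r u :: nat +
  fixes V :: "'a set" and E :: "'a set set"
  assumes finite_V: "finite V"
    and edge_subset: "e \<in> E \<Longrightarrow> e \<subseteq> V"
    and card_edge: "e \<in> E \<Longrightarrow> card e = u"
    and degree: "x \<in> V \<Longrightarrow> card {e\<in>E. x \<in> e} = r"
begin

lemma finite_edge: "e \<in> E \<Longrightarrow> finite e"
  using edge_subset finite_V finite_subset by blast

lemma finite_E: "finite E"
  using edge_subset finite_V by (meson Pow_iff finite_Pow_iff finite_subset subsetI)

lemma empty_notin_E: "{} \<notin> E"
  using card_edge u_ge_2 by fastforce

text \<open>Each \<open>w\<close> other than \<open>z\<close> is reached from the
  \<open>u - 2\<close> vertices of \<open>e\<close> distinct from both, and \<open>z\<close> itself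
  from \<open>u - 1\<close>.\<close>

lemma sum_edge_remove2:
  assumes "e \<in> E" "z \<in> e"
  shows "(\<Sum>y\<in>e - {z}. \<Sum>w\<in>e - {y}. g w :: real)
    = (real u - 2) * (\<Sum>w\<in>e - {z}. g w) + (real u - 1) * g z"
proof -
  define T where "T = sum g e"
  have fin: "finite e" and card: "card e = u" using assms finite_edge card_edge by auto
  have rem: "(\<Sum>w\<in>e - {y}. g w) = T - g y" if "y \<in> e" for y
    using that fin by (simp add: T_def sum_diff1)
  have "(\<Sum>y\<in>e - {z}. \<Sum>w\<in>e - {y}. g w) = (\<Sum>y\<in>e - {z}. T - g y)"
    by (intro sum.cong refl rem) auto
  also have "\<dots> = real (u - 1) * T - (T - g z)"
    using rem[OF assms(2)] assms(2) fin card by (simp add: sum_subtractf)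
  also have "real (u - 1) = real u - 1"
    using u_ge_2 by simp
  finally show ?thesis
    by (simp add: rem[OF assms(2)] algebra_simps)
qed

lemma nbw_split:
  assumes "e \<in> E" "z \<in> e"
  shows "nbw E x (Suc i) z = real (nb E x (Suc i) z e) + (\<Sum>y\<in>e - {z}. real (nb E x i y e))"
proof -
  have "{e'\<in>E. z \<in> e' \<and> e' \<noteq> {}} = insert e {e'\<in>E. z \<in> e' \<and> e' \<noteq> e}"
    using assms by auto
  then show ?thesis
    using finite_E by (simp add: nbw_def)
qed

lemma nbw_Suc: "nbw E x (Suc i) z = (\<Sum>e\<in>{e\<in>E. z \<in> e}. \<Sum>y\<in>e - {z}. real (nb E x i y e))"
proof -
  have "{e'\<in>E. z \<in> e' \<and> e' \<noteq> {}} = {e\<in>E. z \<in> e}"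
    using empty_notin_E by auto
  then show ?thesis
    by (simp add: nbw_def)
qed

lemma nbw_0: "nbw E x 0 z = of_bool (z = x)"
  by (simp add: nbw_def)

lemma nbw_1: "nbw E x (Suc 0) z = adj E (nbw E x 0) z"
proof -
  have "real (nb E x 0 y e) = nbw E x 0 y" for y e by (simp add: nbw_def)
  then show ?thesis unfolding nbw_Suc adj_def by simp
qed

text \<open>A walk of positive length is excluded for exactly one of the \<open>r\<close> edges at
  \<open>z\<close>, its last one; the empty walk is never excluded. This is the origin of
  \<open>k\<close> versus \<open>q\<close> in the recurrence.\<close>

lemma sum_nb_edges:
  assumes "z \<in> V"
  shows "(\<Sum>e\<in>{e\<in>E. z \<in> e}. real (nb E x i z e)) = (if i = 0 then real r else real r - 1) * nbw E x i z"
proof (cases i)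
  case 0
  then show ?thesis using degree[OF assms] by (simp add: nbw_0)
next
  case (Suc j)
  have "(\<Sum>e\<in>{e\<in>E. z \<in> e}. real (nb E x i z e))
      = (\<Sum>e\<in>{e\<in>E. z \<in> e}. nbw E x i z - (\<Sum>y\<in>e - {z}. real (nb E x j y e)))"
    unfolding Suc by (intro sum.cong refl) (auto simp: nbw_split simp del: nb.simps)
  also have "\<dots> = real r * nbw E x i z - nbw E x i z"
    using degree[OF assms] Suc by (simp add: sum_subtractf nbw_Suc)
  finally show ?thesis using Suc by (simp add: algebra_simps)
qed

text \<open>
  An extension of a walk by its own last edge either returns to the vertex before the last one or
  replaces the last vertex by one of the \<open>u - 2\<close> others of that edge.
\<close>

lemma nbw_Suc_Suc:
  assumes "z \<in> V"
  shows "nbw E x (Suc (Suc i)) z = adj E (nbw E x (Suc i)) z - (real u - 2) * nbw E x (Suc i) z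
    - (if i = 0 then k else q) * nbw E x i z"
proof -
  let ?E = "{e\<in>E. z \<in> e}"
  have "adj E (nbw E x (Suc i)) z = (\<Sum>e\<in>?E. \<Sum>y\<in>e - {z}. real (nb E x (Suc i) y e) + (\<Sum>w\<in>e - {y}. real (nb E x i w e)))"
    unfolding adj_def by (intro sum.cong refl nbw_split) auto
  also have "\<dots> = nbw E x (Suc (Suc i)) z + (\<Sum>e\<in>?E. \<Sum>y\<in>e - {z}. \<Sum>w\<in>e - {y}. real (nb E x i w e))"
    by (simp add: sum.distrib nbw_Suc[of x "Suc i"] del: nb.simps)
  also have "(\<Sum>e\<in>?E. \<Sum>y\<in>e - {z}. \<Sum>w\<in>e - {y}. real (nb E x i w e))
     = (\<Sum>e\<in>?E. (real u - 2) * (\<Sum>w\<in>e - {z}. real (nb E x i w e)) + (real u - 1) * real (nb E x i z e))"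
    by (intro sum.cong refl sum_edge_remove2) auto
  also have "\<dots> = (real u - 2) * nbw E x (Suc i) z + (real u - 1) * ((if i = 0 then real r else real r - 1) * nbw E x i z)"
    by (simp only: sum.distrib sum_distrib_left[symmetric] nbw_Suc sum_nb_edges[OF assms])
  finally show ?thesis by (simp add: k_def q_def)
qed

lemma adj_adjacency:
  assumes "y \<in> V"
  shows "adj E f y = (\<Sum>z\<in>V. adjacency E y z * f z)"
proof -
  have "adj E f y = (\<Sum>e\<in>E. if y \<in> e then \<Sum>z\<in>V. if z \<in> e - {y} then f z else 0 else 0)"
    unfolding adj_def
    by (rule sum.mono_neutral_cong_left)
      (use edge_subset finite_E finite_V in \<open>auto simp: sum.If_cases Int_absorb1 intro!: sum.cong\<close>)
  also have "\<dots> = (\<Sum>e\<in>E. \<Sum>z\<in>V. if {y, z} \<subseteq> e \<and> z \<noteq> y then f z else 0)"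
    by (intro sum.cong refl) (auto intro!: sum.cong sum.neutral[symmetric])
  also have "\<dots> = (\<Sum>z\<in>V. \<Sum>e\<in>E. if {y, z} \<subseteq> e \<and> z \<noteq> y then f z else 0)"
    by (rule sum.swap)
  also have "\<dots> = (\<Sum>z\<in>V. adjacency E y z * f z)"
  proof (rule sum.cong[OF refl])
    fix z
    show "(\<Sum>e\<in>E. if {y, z} \<subseteq> e \<and> z \<noteq> y then f z else 0) = adjacency E y z * f z"
      using finite_E by (cases "y = z") (simp_all add: adjacency_def sum.If_cases Collect_conj_eq)
  qed
  finally show ?thesis .
qed

lemma adjacency_sym: "adjacency E x y = adjacency E y x"
  by (simp add: adjacency_def insert_commute)

lemma adj_selfadjoint: "(\<Sum>y\<in>V. v y * adj E f y) = (\<Sum>y\<in>V. adj E v y * f y)"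
proof -
  have "(\<Sum>y\<in>V. v y * adj E f y) = (\<Sum>y\<in>V. \<Sum>z\<in>V. adjacency E y z * v y * f z)"
    by (simp add: adj_adjacency sum_distrib_left mult_ac)
  also have "\<dots> = (\<Sum>z\<in>V. \<Sum>y\<in>V. adjacency E y z * v y * f z)"
    by (rule sum.swap)
  also have "\<dots> = (\<Sum>y\<in>V. adj E v y * f y)"
    by (simp add: adj_adjacency sum_distrib_right adjacency_sym)
  finally show ?thesis .
qed

lemma adj_const:
  assumes "y \<in> V"
  shows "adj E (\<lambda>_. t) y = k * t"
proof -
  have "adj E (\<lambda>_. t) y = (\<Sum>e\<in>{e\<in>E. y \<in> e}. (real u - 1) * t)"
    unfolding adj_def using u_ge_2 by (intro sum.cong refl) (auto simp: card_edge finite_edge of_nat_diff)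
  then show ?thesis using degree[OF assms] by (simp add: k_def)
qed

text \<open>Selfadjointness moves \<open>adj\<close> onto the eigenvector, where it becomes the
  factor \<open>\<mu>\<close>; the recurrence of the walk counts thus turns into that of
  \<open>F\<close>.\<close>

lemma sum_eigenvector_nbw:
  assumes eig: "\<And>y. y \<in> V \<Longrightarrow> adj E v y = \<mu> * v y" and x: "x \<in> V"
  shows "(\<Sum>y\<in>V. v y * nbw E x i y) = poly (F r u i) \<mu> * v x"
proof (induction i rule: less_induct)
  case (less i)
  have adj: "(\<Sum>y\<in>V. v y * adj E f y) = \<mu> * (\<Sum>y\<in>V. v y * f y)" for f
    unfolding adj_selfadjoint sum_distrib_left by (intro sum.cong refl) (simp add: eig)
  have zero: "(\<Sum>y\<in>V. v y * nbw E x 0 y) = v x"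
    using x finite_V by (simp add: nbw_0 of_bool_def if_distrib[of "(*) _"] sum.delta cong: if_cong)
  have Suc_Suc: "(\<Sum>y\<in>V. v y * nbw E x (Suc (Suc j)) y) = \<mu> * (\<Sum>y\<in>V. v y * nbw E x (Suc j) y)
    - (real u - 2) * (\<Sum>y\<in>V. v y * nbw E x (Suc j) y) - (if j = 0 then k else q) * (\<Sum>y\<in>V. v y * nbw E x j y)" for j
  proof -
    have "(\<Sum>y\<in>V. v y * nbw E x (Suc (Suc j)) y) = (\<Sum>y\<in>V. v y * adj E (nbw E x (Suc j)) y
      - (real u - 2) * (v y * nbw E x (Suc j) y) - (if j = 0 then k else q) * (v y * nbw E x j y))"
      by (intro sum.cong refl) (simp add: nbw_Suc_Suc algebra_simps)
    then show ?thesis by (simp add: sum_subtractf sum_distrib_left[symmetric] adj)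
  qed
  consider "i = 0" | "i = Suc 0" | "i = Suc (Suc 0)" | j where "i = Suc (Suc (Suc j))"
    by (metis not0_implies_Suc)
  then show ?case
  proof cases
    case 1
    then show ?thesis using zero by simp
  next
    case 2
    then show ?thesis using zero by (simp add: nbw_1 adj)
  next
    case 3
    then show ?thesis using Suc_Suc[of 0] less[of 0] less[of "Suc 0"]
      by (simp add: k_def power2_eq_square algebra_simps)
  next
    case 4
    then show ?thesis using Suc_Suc[of "Suc j"] less[of "Suc j"] less[of "Suc (Suc j)"]
      by (simp add: q_def algebra_simps)
  qed
qed

section \<open>Cumulative walk counts: row \<open>x\<close> of \<open>G_i(A)\<close>\<close>

definition nbw_upto :: "'a \<Rightarrow> nat \<Rightarrow> 'a \<Rightarrow> real" where
  "nbw_upto x i z = (\<Sum>j\<le>i. nbw E x j z)"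

lemma nbw_nonneg: "0 \<le> nbw E x i z"
  by (simp add: nbw_def)

lemma nbw_upto_0: "nbw_upto x 0 z = nbw E x 0 z"
  by (simp add: nbw_upto_def)

lemma nbw_upto_Suc: "nbw_upto x (Suc i) z = nbw_upto x i z + nbw E x (Suc i) z"
  by (simp add: nbw_upto_def)

lemma nbw_upto_nonneg: "0 \<le> nbw_upto x i z"
  by (simp add: nbw_upto_def nbw_nonneg sum_nonneg)

lemma nbw_upto_mono: "i \<le> j \<Longrightarrow> nbw_upto x i z \<le> nbw_upto x j z"
  unfolding nbw_upto_def by (rule sum_mono2) (auto simp: nbw_nonneg)

lemma nbw_upto_ge_1:
  assumes "nbw_upto x i z \<noteq> 0"
  shows "1 \<le> nbw_upto x i z"
proof -
  have "nbw_upto x i z = real (\<Sum>j\<le>i. nb E x j z {})"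
    by (simp add: nbw_upto_def nbw_def)
  then show ?thesis using assms by (metis One_nat_def Suc_leI neq0_conv of_nat_0 of_nat_1 of_nat_mono)
qed

lemma sum_eigenvector_nbw_upto:
  assumes eig: "\<And>y. y \<in> V \<Longrightarrow> adj E v y = \<mu> * v y" and x: "x \<in> V"
  shows "(\<Sum>y\<in>V. v y * nbw_upto x i y) = poly (G r u i) \<mu> * v x"
proof -
  have "(\<Sum>y\<in>V. v y * nbw_upto x i y) = (\<Sum>j\<le>i. \<Sum>y\<in>V. v y * nbw E x j y)"
    unfolding nbw_upto_def sum_distrib_left by (rule sum.swap)
  then show ?thesis
    by (simp add: sum_eigenvector_nbw[OF eig x] G_def poly_sum sum_distrib_right)
qed

lemma nbw_upto_Suc_Suc:
  assumes "z \<in> V"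
  shows "nbw_upto x (Suc (Suc i)) z
    = adj E (nbw_upto x (Suc i)) z - (real u - 2) * nbw_upto x (Suc i) z - q * nbw_upto x i z"
proof (induction i)
  case 0
  have "adj E (nbw_upto x (Suc 0)) z = adj E (nbw E x 0) z + adj E (nbw E x (Suc 0)) z"
    by (simp add: adj_def nbw_upto_0 nbw_upto_Suc sum.distrib)
  then show ?case using nbw_Suc_Suc[OF assms, of x 0] nbw_1[of x z]
    nbw_upto_Suc[of x "Suc 0" z] nbw_upto_Suc[of x 0 z] nbw_upto_0[of x z]
    by (simp add: k_eq algebra_simps)
next
  case (Suc i)
  have "adj E (nbw_upto x (Suc (Suc i))) z = adj E (nbw_upto x (Suc i)) z + adj E (nbw E x (Suc (Suc i))) z"
    by (simp add: adj_def nbw_upto_Suc[of x "Suc i"] sum.distrib)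
  with Suc nbw_Suc_Suc[OF assms, of x "Suc i"] nbw_upto_Suc[of x "Suc (Suc i)" z]
    nbw_upto_Suc[of x "Suc i" z] nbw_upto_Suc[of x i z]
  show ?case by (simp add: algebra_simps)
qed

lemma nbw_upto_1:
  assumes "z \<in> V"
  shows "nbw_upto x (Suc 0) z = adj E (nbw_upto x 0) z + nbw_upto x 0 z"
  by (simp add: nbw_upto_def nbw_1 adj_def)

section \<open>Reduction of arbitrary walks to nonbacktracking ones\<close>

lemma nb_step:
  assumes "e \<in> E" "e \<noteq> e'" "z \<in> e" "y \<in> e" "y \<noteq> z" "0 < nb E x i y e"
  shows "0 < nb E x (Suc i) z e'"
proof -
  have "0 < (\<Sum>y\<in>e - {z}. nb E x i y e)"
    using assms finite_edge by (intro sum_pos2[of _ y]) auto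
  then have "0 < (\<Sum>e\<in>{e \<in> E. z \<in> e \<and> e \<noteq> e'}. \<Sum>y\<in>e - {z}. nb E x i y e)"
    using assms finite_E by (intro sum_pos2[of _ e]) auto
  then show ?thesis by simp
qed

lemma nb_pos_nbw_pos:
  assumes "0 < nb E x i z e"
  shows "0 < nbw E x i z"
proof (cases i)
  case 0
  then show ?thesis using assms by (simp add: nbw_0 split: if_splits)
next
  case (Suc j)
  have "nb E x (Suc j) z e \<le> nb E x (Suc j) z {}"
    unfolding nb.simps using finite_E empty_notin_E by (intro sum_mono2) auto
  with assms Suc show ?thesis by (simp add: nbw_def del: nb.simps)
qed

text \<open>If some walk to \<open>y\<close> does not end with \<open>e\<close>, it can be extended
  along \<open>e\<close>. Otherwise its last step, taken inside \<open>e\<close>, is dropped or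
  redirected to \<open>z\<close>, which adds no length.\<close>

lemma nbw_pos_extend:
  assumes "0 < nbw E x i y" and e: "e \<in> E" "y \<in> e" "z \<in> e" "y \<noteq> z"
  shows "\<exists>j\<le>Suc i. 0 < nbw E x j z"
proof (cases "0 < nb E x i y e")
  case True
  then have "0 < nb E x (Suc i) z {}"
    using e empty_notin_E by (intro nb_step[of e]) auto
  then show ?thesis unfolding nbw_def by (intro exI[of _ "Suc i"]) (simp del: nb.simps)
next
  case False
  then obtain j where i: "i = Suc j"
    using assms(1) by (cases i) (auto simp: nbw_0)
  have "nbw E x i y = (\<Sum>w\<in>e - {y}. real (nb E x j w e))"
    using False nbw_split[OF e(1,2), of x j] i by simp
  then obtain w where w: "w \<in> e - {y}" "0 < nb E x j w e"
    using assms(1) by (cases "\<forall>w\<in>e - {y}. nb E x j w e = 0") auto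
  show ?thesis
  proof (cases "w = z")
    case True
    then show ?thesis using w nb_pos_nbw_pos i by (intro exI[of _ j]) auto
  next
    case False
    then have "0 < nb E x (Suc j) z {}"
      using e w empty_notin_E by (intro nb_step[of e _ _ w]) auto
    then show ?thesis unfolding nbw_def i by (intro exI[of _ "Suc j"]) (simp del: nb.simps)
  qed
qed

lemma nbw_pos_of_walk:
  assumes "walk V E xs es"
  shows "i \<le> length es \<Longrightarrow> \<exists>j\<le>i. 0 < nbw E (hd xs) j (xs ! i)"
proof (induction i)
  case 0
  have "xs \<noteq> []" using assms by (auto simp: walk_def)
  then show ?case by (simp add: nbw_0 hd_conv_nth)
next
  case (Suc i)
  then obtain j where j: "j \<le> i" "0 < nbw E (hd xs) j (xs ! i)" by auto
  have "es ! i \<in> E" "xs ! i \<in> es ! i" "xs ! Suc i \<in> es ! i" "xs ! i \<noteq> xs ! Suc i"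
    using assms Suc.prems by (auto simp: walk_def subset_iff)
  from nbw_pos_extend[OF j(2) this] obtain j' where "j' \<le> Suc j" "0 < nbw E (hd xs) j' (xs ! Suc i)"
    by blast
  then show ?case using j(1) by (intro exI[of _ j']) auto
qed

text \<open>The infimum defining the distance is attained by a walk of length at most
  \<open>d\<close>, which yields a nonbacktracking walk no longer than it.\<close>

lemma nbw_upto_diameter:
  assumes conn: "connected_hypergraph V E" and diam: "diameter V E = enat d"
    and xy: "x \<in> V" "y \<in> V"
  shows "1 \<le> nbw_upto x d y"
proof -
  have "distance V E x y \<le> enat d"
    unfolding diam[symmetric] diameter_def using xy by (intro Sup_upper) auto
  moreover have "{enat p |p. walk_betw V E x y p} \<noteq> {}"
    using conn xy by (auto simp: connected_hypergraph_def)
  then have "distance V E x y \<in> {enat p |p. walk_betw V E x y p}"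
    unfolding distance_def Inf_enat_def by (auto intro: LeastI)
  ultimately obtain p where p: "p \<le> d" "walk_betw V E x y p" by auto
  then obtain xs es where w: "walk V E xs es" "hd xs = x" "last xs = y" "length es = p"
    by (auto simp: walk_betw_def)
  then have "xs ! p = y"
    by (metis diff_Suc_1 last_conv_nth length_0_conv nat.distinct(1) walk_def)
  with nbw_pos_of_walk[OF w(1), of p] w obtain j where j: "j \<le> p" "0 < nbw E x j y" by auto
  have "nbw E x j y \<le> nbw_upto x d y"
    unfolding nbw_upto_def using j p by (intro member_le_sum) (auto simp: nbw_nonneg)
  with j nbw_upto_ge_1[of x d y] show ?thesis by linarith
qed

end

section \<open>Rayleigh quotients orthogonal to the constants\<close>

context regular_uniform_hypergraph begin

lemma adj_add: "adj E (\<lambda>y. f y + t * g y) x = adj E f x + t * adj E g x"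
  by (simp add: adj_def sum.distrib sum_distrib_left)

lemma adj_scale: "adj E (\<lambda>y. t * f y) x = t * adj E f x"
  by (simp add: adj_def sum_distrib_left)

lemma adj_cong: "(\<And>y. y \<in> V \<Longrightarrow> f y = g y) \<Longrightarrow> x \<in> V \<Longrightarrow> adj E f x = adj E g x"
  by (simp add: adj_adjacency)

lemma sum_adj: "(\<Sum>y\<in>V. adj E f y) = k * (\<Sum>y\<in>V. f y)"
  using adj_selfadjoint[of "\<lambda>_. 1" f] by (simp add: adj_const sum_distrib_left)

definition rayleigh :: "('a \<Rightarrow> real) \<Rightarrow> real" where
  "rayleigh f = (\<Sum>y\<in>V. f y * adj E f y)"

text \<open>Vectors are functions on the whole type that vanish off \<open>V\<close>. The set is
  then closed inside a product of intervals \<open>[-1, 1]\<close>, which is compact by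
  Tychonoff.\<close>

lemma compact_unit_mean_zero:
  "compact {f :: 'a \<Rightarrow> real. (\<forall>x. x \<notin> V \<longrightarrow> f x = 0) \<and> (\<Sum>y\<in>V. f y) = 0 \<and> (\<Sum>y\<in>V. (f y)\<^sup>2) = 1}"
  (is "compact ?S")
proof -
  let ?K = "PiE UNIV (\<lambda>_. {-1..1}) :: ('a \<Rightarrow> real) set"
  have "compactin (product_topology (\<lambda>_. euclidean) UNIV) ?K"
    by (subst compactin_PiE) auto
  then have K: "compact ?K" by (simp add: euclidean_product_topology)
  have coord: "continuous_on UNIV (\<lambda>f :: 'a \<Rightarrow> real. f x)" for x
    by (rule continuous_on_product_coordinates)
  have "closed ((\<Inter>x\<in>-V. {f :: 'a \<Rightarrow> real. f x = 0}) \<inter> ({f. (\<Sum>y\<in>V. f y) = 0} \<inter> {f. (\<Sum>y\<in>V. (f y)\<^sup>2) = 1}))"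
    by (intro closed_Int closed_INT ballI closed_Collect_eq continuous_intros coord)
  also have "(\<Inter>x\<in>-V. {f :: 'a \<Rightarrow> real. f x = 0}) \<inter> ({f. (\<Sum>y\<in>V. f y) = 0} \<inter> {f. (\<Sum>y\<in>V. (f y)\<^sup>2) = 1}) = ?S"
    by auto
  finally have "compact (?K \<inter> ?S)" using K by (rule compact_Int_closed[rotated])
  moreover have "?S \<subseteq> ?K"
  proof
    fix f assume f: "f \<in> ?S"
    have "\<bar>f x\<bar> \<le> 1" for x
    proof (cases "x \<in> V")
      case True
      then have "(f x)\<^sup>2 \<le> (\<Sum>y\<in>V. (f y)\<^sup>2)" using finite_V by (intro member_le_sum) auto
      then show ?thesis using f by (simp add: abs_square_le_1)
    qed (use f in auto)
    then show "f \<in> ?K" by (auto simp: abs_le_iff minus_le_iff)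
  qed
  ultimately show ?thesis by (simp add: inf.absorb2)
qed

lemma continuous_rayleigh: "continuous_on S rayleigh"
proof -
  have coord: "continuous_on S (\<lambda>f :: 'a \<Rightarrow> real. f x)" for x
    by (rule continuous_on_subset[OF continuous_on_product_coordinates]) simp
  have "rayleigh = (\<lambda>f. \<Sum>y\<in>V. f y * (\<Sum>e\<in>{e\<in>E. y \<in> e}. \<Sum>z\<in>e - {y}. f z))"
    by (simp add: fun_eq_iff rayleigh_def adj_def)
  then show ?thesis by (simp only:) (intro continuous_on_sum continuous_on_mult coord)
qed

text \<open>Compactness provides a maximizer of the Rayleigh quotient among mean-zero vectors, and a
  perturbation argument shows that it is an eigenvector.\<close>

lemma exists_max_rayleigh:
  assumes "2 \<le> card V"
  obtains v \<mu> where "\<And>y. y \<in> V \<Longrightarrow> adj E v y = \<mu> * v y" "(\<Sum>y\<in>V. v y) = 0" "\<exists>y\<in>V. v y \<noteq> 0"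
    "\<And>w. (\<Sum>y\<in>V. w y) = 0 \<Longrightarrow> rayleigh w \<le> \<mu> * (\<Sum>y\<in>V. (w y)\<^sup>2)"
proof -
  let ?S = "{f :: 'a \<Rightarrow> real. (\<forall>x. x \<notin> V \<longrightarrow> f x = 0) \<and> (\<Sum>y\<in>V. f y) = 0 \<and> (\<Sum>y\<in>V. (f y)\<^sup>2) = 1}"
  have normalize: "(\<lambda>y. if y \<in> V then 1 / sqrt (\<Sum>y\<in>V. (w y)\<^sup>2) * w y else 0) \<in> ?S"
    and rayleigh_normalize: "rayleigh (\<lambda>y. if y \<in> V then 1 / sqrt (\<Sum>y\<in>V. (w y)\<^sup>2) * w y else 0)
      = rayleigh w / (\<Sum>y\<in>V. (w y)\<^sup>2)"
    if "(\<Sum>y\<in>V. w y) = 0" "0 < (\<Sum>y\<in>V. (w y)\<^sup>2)" for w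
  proof -
    let ?w = "\<lambda>y. if y \<in> V then 1 / sqrt (\<Sum>y\<in>V. (w y)\<^sup>2) * w y else 0"
    have "(\<Sum>y\<in>V. ?w y) = 1 / sqrt (\<Sum>y\<in>V. (w y)\<^sup>2) * (\<Sum>y\<in>V. w y)"
      by (simp add: sum_distrib_left)
    moreover have "(\<Sum>y\<in>V. (?w y)\<^sup>2) = (1 / sqrt (\<Sum>y\<in>V. (w y)\<^sup>2))\<^sup>2 * (\<Sum>y\<in>V. (w y)\<^sup>2)"
      unfolding sum_distrib_left by (intro sum.cong refl) (simp add: power_divide)
    ultimately show "?w \<in> ?S" using that by (simp add: power_divide)
    have "rayleigh ?w = (\<Sum>y\<in>V. (1 / sqrt (\<Sum>y\<in>V. (w y)\<^sup>2))\<^sup>2 * (w y * adj E w y))"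
      unfolding rayleigh_def
    proof (intro sum.cong refl)
      fix y assume y: "y \<in> V"
      have "adj E ?w y = adj E (\<lambda>y. 1 / sqrt (\<Sum>y\<in>V. (w y)\<^sup>2) * w y) y"
        using y by (intro adj_cong) auto
      with y show "?w y * adj E ?w y = (1 / sqrt (\<Sum>y\<in>V. (w y)\<^sup>2))\<^sup>2 * (w y * adj E w y)"
        by (simp only: adj_scale) (simp add: power2_eq_square)
    qed
    then show "rayleigh ?w = rayleigh w / (\<Sum>y\<in>V. (w y)\<^sup>2)"
      using that by (simp add: rayleigh_def power_divide flip: sum_distrib_left sum_divide_distrib)
  qed
  \<comment> \<open>Two vertices give a nonzero mean-zero vector, so the maximum is over a nonempty
    set.\<close>
  obtain a b where ab: "a \<in> V" "b \<in> V" "a \<noteq> b"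
    using assms finite_V by (metis card_le_Suc0_iff_eq not_less_eq_eq numeral_2_eq_2)
  define f :: "'a \<Rightarrow> real" where "f = (\<lambda>y. of_bool (y = a) - of_bool (y = b))"
  have "(\<Sum>y\<in>V. f y) = 0"
    using ab finite_V by (simp add: f_def sum_subtractf of_bool_def sum.delta)
  moreover have "0 < (\<Sum>y\<in>V. (f y)\<^sup>2)"
    using ab finite_V by (intro sum_pos2[of _ a]) (auto simp: f_def)
  ultimately have "?S \<noteq> {}" using normalize[of f] by (metis empty_iff)
  with continuous_attains_sup[OF compact_unit_mean_zero _ continuous_rayleigh]
  obtain v where v: "v \<in> ?S" "\<And>f. f \<in> ?S \<Longrightarrow> rayleigh f \<le> rayleigh v" by blast
  define \<mu> where "\<mu> = rayleigh v"
  have max: "rayleigh w \<le> \<mu> * (\<Sum>y\<in>V. (w y)\<^sup>2)" if "(\<Sum>y\<in>V. w y) = 0" for w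
  proof (cases "(\<Sum>y\<in>V. (w y)\<^sup>2) = 0")
    case True
    then have "\<forall>y\<in>V. w y = 0" using finite_V by (simp add: sum_nonneg_eq_0_iff)
    then show ?thesis by (simp add: rayleigh_def)
  next
    case False
    then have pos: "0 < (\<Sum>y\<in>V. (w y)\<^sup>2)" by (simp add: sum_nonneg order_less_le)
    show ?thesis
      using v(2)[OF normalize[OF that pos]] pos
      unfolding rayleigh_normalize[OF that pos] \<mu>_def by (simp add: pos_divide_le_eq)
  qed
  have v_sums: "(\<Sum>y\<in>V. v y) = 0" "(\<Sum>y\<in>V. (v y)\<^sup>2) = 1" using v(1) by auto
  \<comment> \<open>The residual has mean zero because \<open>adj\<close> preserves mean zero, so
    \<open>v\<close> may be perturbed in its direction.\<close>
  define \<rho> where "\<rho> y = adj E v y - \<mu> * v y" for y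
  have sum_\<rho>: "(\<Sum>y\<in>V. \<rho> y) = 0"
    by (simp add: \<rho>_def sum_subtractf sum_adj v_sums flip: sum_distrib_left)
  define D where "D = (\<Sum>y\<in>V. (\<rho> y)\<^sup>2)"
  define C where "C = \<mu> * D - rayleigh \<rho>"
  have step: "2 * t * D \<le> t\<^sup>2 * C" for t
  proof -
    have "(\<Sum>y\<in>V. v y + t * \<rho> y) = 0"
      by (simp add: sum.distrib v_sums sum_\<rho> flip: sum_distrib_left)
    then have le: "rayleigh (\<lambda>y. v y + t * \<rho> y) \<le> \<mu> * (\<Sum>y\<in>V. (v y + t * \<rho> y)\<^sup>2)" by (rule max)
    have "rayleigh (\<lambda>y. v y + t * \<rho> y)
      = rayleigh v + t * (\<Sum>y\<in>V. v y * adj E \<rho> y) + t * (\<Sum>y\<in>V. \<rho> y * adj E v y) + t\<^sup>2 * rayleigh \<rho>"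
      unfolding rayleigh_def adj_add
      by (simp add: sum.distrib sum_distrib_left power2_eq_square algebra_simps)
    also have "(\<Sum>y\<in>V. v y * adj E \<rho> y) = (\<Sum>y\<in>V. \<rho> y * adj E v y)"
      using adj_selfadjoint[of v \<rho>] by (simp add: mult.commute)
    finally have lhs: "rayleigh (\<lambda>y. v y + t * \<rho> y) = \<mu> + 2 * t * (\<Sum>y\<in>V. \<rho> y * adj E v y) + t\<^sup>2 * rayleigh \<rho>"
      by (simp add: \<mu>_def)
    have rhs: "(\<Sum>y\<in>V. (v y + t * \<rho> y)\<^sup>2) = 1 + 2 * t * (\<Sum>y\<in>V. \<rho> y * v y) + t\<^sup>2 * D"
      unfolding D_def v_sums(2)[symmetric]
      by (simp add: sum.distrib sum_distrib_left power2_eq_square algebra_simps)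
    have D: "D = (\<Sum>y\<in>V. \<rho> y * adj E v y) - \<mu> * (\<Sum>y\<in>V. \<rho> y * v y)"
      unfolding D_def by (simp add: \<rho>_def power2_eq_square sum_distrib_left algebra_simps flip: sum_subtractf sum.distrib)
    show ?thesis using le unfolding lhs rhs C_def D by (simp add: algebra_simps)
  qed
  have "D = 0"
  proof (rule ccontr)
    assume "D \<noteq> 0"
    then have D: "0 < D" by (simp add: D_def sum_nonneg order_less_le)
    \<comment> \<open>With this \<open>t\<close> the second-order gain \<open>t\<^sup>2 * C\<close>
      is at most \<open>t * D\<close>, too small for the first-order term
      \<open>2 * t * D\<close>.\<close>
    define t where "t = D / (\<bar>C\<bar> + 1)"
    have t: "0 < t" "t * (\<bar>C\<bar> + 1) = D" using D by (auto simp: t_def)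
    have "t * C \<le> t * (\<bar>C\<bar> + 1)" using t by (intro mult_left_mono) auto
    then have "t * (t * C) \<le> t * D" using t by (intro mult_left_mono) auto
    moreover have "0 < t * D" using t D by simp
    ultimately show False using step[of t] by (simp add: power2_eq_square algebra_simps)
  qed
  then have "adj E v y = \<mu> * v y" if "y \<in> V" for y
    using that finite_V by (simp add: D_def sum_nonneg_eq_0_iff \<rho>_def)
  moreover have "\<exists>y\<in>V. v y \<noteq> 0" using v_sums(2) by (cases "\<forall>y\<in>V. v y = 0") auto
  ultimately show thesis using that v_sums(1) max by blast
qed

end

section \<open>Bounds on eigenvalues and on the order\<close>

context regular_uniform_hypergraph begin

text \<open>The eigenvector equation is read at a vertex where \<open>\<bar>v\<bar>\<close> is
  largest.\<close>

lemma abs_le_of_nonneg_kernel: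
  assumes nonneg: "\<And>x y. x \<in> V \<Longrightarrow> y \<in> V \<Longrightarrow> 0 \<le> M x y"
    and row: "\<And>x. x \<in> V \<Longrightarrow> (\<Sum>y\<in>V. M x y) = R"
    and eig: "\<And>x. x \<in> V \<Longrightarrow> (\<Sum>y\<in>V. v y * M x y) = t * v x"
    and nz: "\<exists>y\<in>V. v y \<noteq> (0 :: real)"
  shows "\<bar>t\<bar> \<le> R"
proof -
  obtain x where x: "x \<in> V" "\<And>y. y \<in> V \<Longrightarrow> \<bar>v y\<bar> \<le> \<bar>v x\<bar>"
  proof -
    have "(\<lambda>y. \<bar>v y\<bar>) ` V \<noteq> {}" "finite ((\<lambda>y. \<bar>v y\<bar>) ` V)" using nz finite_V by auto
    from Max_in[OF this(2,1)] Max_ge[OF this(2)] that show thesis by auto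
  qed
  have "\<bar>t\<bar> * \<bar>v x\<bar> = \<bar>\<Sum>y\<in>V. v y * M x y\<bar>" by (simp add: eig x abs_mult)
  also have "\<dots> \<le> (\<Sum>y\<in>V. \<bar>v y * M x y\<bar>)" by (rule sum_abs)
  also have "\<dots> \<le> (\<Sum>y\<in>V. \<bar>v x\<bar> * M x y)"
    using x nonneg by (intro sum_mono) (auto simp: abs_mult intro!: mult_right_mono)
  also have "\<dots> = R * \<bar>v x\<bar>" by (simp add: row x flip: sum_distrib_left)
  finally have "\<bar>t\<bar> * \<bar>v x\<bar> \<le> R * \<bar>v x\<bar>" .
  moreover have "v x \<noteq> 0"
  proof
    assume "v x = 0"
    then have "\<bar>v y\<bar> \<le> 0" if "y \<in> V" for y using x(2)[OF that] by simp
    with nz show False by auto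
  qed
  ultimately show ?thesis by simp
qed

lemma sum_nbw: "x \<in> V \<Longrightarrow> (\<Sum>y\<in>V. nbw E x i y) = poly (F r u i) k"
  using sum_eigenvector_nbw[of "\<lambda>_. 1" k x i] by (simp add: adj_const)

lemma sum_nbw_upto: "x \<in> V \<Longrightarrow> (\<Sum>y\<in>V. nbw_upto x i y) = poly (G r u i) k"
  using sum_eigenvector_nbw_upto[of "\<lambda>_. 1" k x i] by (simp add: adj_const)

lemma abs_F_eigenvalue_le:
  assumes "\<And>y. y \<in> V \<Longrightarrow> adj E v y = \<mu> * v y" "\<exists>y\<in>V. v y \<noteq> 0"
  shows "\<bar>poly (F r u i) \<mu>\<bar> \<le> poly (F r u i) k"
  using assms by (intro abs_le_of_nonneg_kernel[of "\<lambda>x. nbw E x i" _ v])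
    (auto simp: nbw_nonneg sum_nbw sum_eigenvector_nbw)

text \<open>The kernel is \<open>G_d(A) - J\<close>, nonnegative by \<open>cover\<close>;
  \<open>J\<close> annihilates the mean-zero \<open>v\<close> but lowers the row sum by
  \<open>card V\<close>.\<close>

lemma abs_G_eigenvalue_le:
  assumes eig: "\<And>y. y \<in> V \<Longrightarrow> adj E v y = \<mu> * v y" and nz: "\<exists>y\<in>V. v y \<noteq> 0" and mean: "(\<Sum>y\<in>V. v y) = 0"
    and cover: "\<And>x y. x \<in> V \<Longrightarrow> y \<in> V \<Longrightarrow> 1 \<le> nbw_upto x d y"
  shows "\<bar>poly (G r u d) \<mu>\<bar> \<le> poly (G r u d) k - real (card V)"
proof (rule abs_le_of_nonneg_kernel[of "\<lambda>x y. nbw_upto x d y - 1" _ v])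
  fix x assume x: "x \<in> V"
  show "(\<Sum>y\<in>V. v y * (nbw_upto x d y - 1)) = poly (G r u d) \<mu> * v x"
    using sum_eigenvector_nbw_upto[OF eig x] mean by (simp add: right_diff_distrib sum_subtractf)
qed (use cover nz in \<open>auto simp: sum_subtractf sum_nbw_upto\<close>)

text \<open>The Christoffel-Darboux identity with \<open>A\<close> in place of one variable and
  \<open>\<sigma>\<close> in place of the other, read in row \<open>x\<close>.\<close>

lemma adj_christoffel_darboux:
  assumes "y \<in> V"
  shows "adj E (\<lambda>y. \<Sum>j\<le>i. q ^ (i - j) * poly (G r u j) \<sigma> * nbw_upto x j y) y
      - \<sigma> * (\<Sum>j\<le>i. q ^ (i - j) * poly (G r u j) \<sigma> * nbw_upto x j y)
    = poly (G r u i) \<sigma> * nbw_upto x (Suc i) y - poly (G r u (Suc i)) \<sigma> * nbw_upto x i y"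
proof (induction i)
  case 0
  then show ?case using nbw_upto_1[OF assms, of x] by (simp add: G_0 G_1 algebra_simps)
next
  case (Suc i)
  define H where "H i y = (\<Sum>j\<le>i. q ^ (i - j) * poly (G r u j) \<sigma> * nbw_upto x j y)" for i y
  have H: "H (Suc i) y = q * H i y + poly (G r u (Suc i)) \<sigma> * nbw_upto x (Suc i) y" for y
    by (simp add: H_def sum_distrib_left Suc_diff_le mult_ac)
  have adjH: "adj E (H (Suc i)) y = q * adj E (H i) y + poly (G r u (Suc i)) \<sigma> * adj E (nbw_upto x (Suc i)) y"
    unfolding H by (simp add: adj_add adj_scale)
  have IH: "adj E (H i) y = \<sigma> * H i y + poly (G r u i) \<sigma> * nbw_upto x (Suc i) y - poly (G r u (Suc i)) \<sigma> * nbw_upto x i y"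
    using Suc by (simp add: H_def[abs_def])
  have rec: "adj E (nbw_upto x (Suc i)) y
     = nbw_upto x (Suc (Suc i)) y + (real u - 2) * nbw_upto x (Suc i) y + q * nbw_upto x i y"
    by (simp add: nbw_upto_Suc_Suc[OF assms])
  have "adj E (H (Suc i)) y - \<sigma> * H (Suc i) y = poly (G r u (Suc i)) \<sigma> * nbw_upto x (Suc (Suc i)) y
     - poly (G r u (Suc (Suc i))) \<sigma> * nbw_upto x (Suc i) y"
    unfolding adjH IH rec H G_Suc_Suc by (simp add: algebra_simps)
  then show ?case by (simp only: H_def[abs_def])
qed

text \<open>Split \<open>f\<close> into its mean and a mean-zero part: the latter contributes
  nothing positive, and the constants have eigenvalue \<open>k - \<sigma>\<close>.\<close>

lemma rayleigh_shift_le: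
  assumes max: "\<And>w. (\<Sum>y\<in>V. w y) = 0 \<Longrightarrow> rayleigh w \<le> \<sigma> * (\<Sum>y\<in>V. (w y)\<^sup>2)"
    and V: "V \<noteq> {}"
  shows "(\<Sum>y\<in>V. f y * (adj E f y - \<sigma> * f y)) \<le> (k - \<sigma>) * (\<Sum>y\<in>V. f y)\<^sup>2 / real (card V)"
proof -
  define n where "n = real (card V)"
  have n: "0 < n" using V finite_V by (simp add: n_def card_gt_0_iff)
  define t where "t = (\<Sum>y\<in>V. f y) / n"
  define w where "w y = f y - t" for y
  have w: "(\<Sum>y\<in>V. w y) = 0" using n by (simp add: w_def sum_subtractf t_def n_def)
  have adjf: "adj E f y = adj E w y + k * t" if "y \<in> V" for y
    using adj_add[of w t "\<lambda>_. 1" y] adj_const[OF that, of 1] by (simp add: w_def)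
  have "(\<Sum>y\<in>V. f y * (adj E f y - \<sigma> * f y))
      = (\<Sum>y\<in>V. w y * adj E w y - \<sigma> * (w y)\<^sup>2 + t * adj E w y + (k - 2 * \<sigma>) * t * w y + (k - \<sigma>) * t\<^sup>2)"
    by (intro sum.cong refl) (simp add: adjf, simp add: w_def power2_eq_square algebra_simps)
  also have "\<dots> = rayleigh w - \<sigma> * (\<Sum>y\<in>V. (w y)\<^sup>2) + (k - \<sigma>) * t\<^sup>2 * n"
    by (simp add: sum.distrib sum_subtractf sum_adj w rayleigh_def n_def flip: sum_distrib_left)
  also have "\<dots> \<le> (k - \<sigma>) * t\<^sup>2 * n" using max[OF w] by simp
  also have "\<dots> = (k - \<sigma>) * (\<Sum>y\<in>V. f y)\<^sup>2 / n"
    using n by (simp add: t_def power2_eq_square)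
  finally show ?thesis by (simp add: n_def)
qed

text \<open>
  The linear programming bound for the polynomial \<open>f = (x - \<sigma>) h\<^sup>2 = \<gamma> g h\<close> with
  \<open>g = G\<^sub>i\<^sub>+\<^sub>1 + a G\<^sub>i\<close>, which is nonpositive on the nontrivial eigenvalues: the diagonal entry of
  \<open>f(A)\<close> at \<open>x\<close> is at most \<open>f(k) / n\<close>, and it is at least \<open>\<gamma> (1 + a) h(k)\<close> since \<open>g(A)\<close> is at
  least \<open>1 + a\<close> wherever \<open>h(A)\<close> does not vanish.
\<close>

lemma linear_programming_bound:
  assumes max: "\<And>w. (\<Sum>y\<in>V. w y) = 0 \<Longrightarrow> rayleigh w \<le> \<sigma> * (\<Sum>y\<in>V. (w y)\<^sup>2)"
    and x: "x \<in> V" and pos: "\<And>j. j \<le> i \<Longrightarrow> 0 < poly (G r u j) \<sigma>"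
    and a: "0 \<le> a" and root: "poly (G r u (Suc i)) \<sigma> = - a * poly (G r u i) \<sigma>"
  shows "(1 + a) * real (card V) \<le> poly (G r u (Suc i)) k + a * poly (G r u i) k"
proof -
  define \<gamma> where "\<gamma> = poly (G r u i) \<sigma>"
  define n where "n = real (card V)"
  \<comment> \<open>Row \<open>x\<close> of \<open>h(A)\<close>; its sum, called \<open>h\<close>
    below, is the value \<open>h(k)\<close>.\<close>
  define H where "H y = (\<Sum>j\<le>i. q ^ (i - j) * poly (G r u j) \<sigma> * nbw_upto x j y)" for y
  define h where "h = (\<Sum>y\<in>V. H y)"
  define g where "g y = nbw_upto x (Suc i) y + a * nbw_upto x i y" for y
  define gk where "gk = poly (G r u (Suc i)) k + a * poly (G r u i) k"
  have \<gamma>: "0 < \<gamma>" using pos by (simp add: \<gamma>_def)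
  have q: "0 < q" using q_ge by simp
  have n: "0 < n" using x finite_V by (auto simp: n_def card_gt_0_iff)
  have adjH: "adj E H y - \<sigma> * H y = \<gamma> * g y" if "y \<in> V" for y
    using adj_christoffel_darboux[OF that, of i \<sigma> x]
    by (simp add: H_def[abs_def] g_def root \<gamma>_def algebra_simps)
  have sum_g: "(\<Sum>y\<in>V. g y) = gk"
    using x by (simp add: g_def gk_def sum.distrib sum_nbw_upto flip: sum_distrib_left)
  have "(\<Sum>y\<in>V. adj E H y - \<sigma> * H y) = \<gamma> * gk"
    unfolding sum_g[symmetric] sum_distrib_left by (intro sum.cong refl adjH)
  then have kh: "(k - \<sigma>) * h = \<gamma> * gk"
    by (simp add: sum_subtractf sum_adj h_def left_diff_distrib flip: sum_distrib_left)
  have H_nonneg: "0 \<le> H y" for y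
    unfolding H_def using pos q by (intro sum_nonneg mult_nonneg_nonneg) (auto simp: nbw_upto_nonneg less_imp_le)
  have "0 < H x"
    unfolding H_def
  proof (rule sum_pos2[of _ 0])
    show "0 < q ^ (i - 0) * poly (G r u 0) \<sigma> * nbw_upto x 0 x"
      using q by (simp add: G_0 nbw_upto_0 nbw_0)
  qed (use pos q in \<open>auto intro!: mult_nonneg_nonneg simp: nbw_upto_nonneg less_imp_le\<close>)
  then have h: "0 < h"
    unfolding h_def using x finite_V H_nonneg by (intro sum_pos2[of _ x]) auto
  have gH: "(1 + a) * H y \<le> H y * g y" for y
  proof (cases "H y = 0")
    case False
    then obtain j where j: "j \<le> i" "nbw_upto x j y \<noteq> 0"
      unfolding H_def by (metis (no_types, lifting) atMost_iff mult_zero_right sum.neutral)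
    then have "1 \<le> nbw_upto x i y" using nbw_upto_ge_1[of x j y] nbw_upto_mono[of j i x y] by simp
    moreover from this have "1 \<le> nbw_upto x (Suc i) y" using nbw_upto_mono[of i "Suc i" x y] by simp
    ultimately have "1 + a \<le> g y" unfolding g_def using a
      by (metis add_mono mult.right_neutral mult_left_mono)
    then show ?thesis using H_nonneg[of y] by (metis mult.commute mult_right_mono)
  qed simp
  \<comment> \<open>The sum of \<open>H y * (adj E H y - \<sigma> * H y)\<close> is the diagonal
    entry at \<open>x\<close> of \<open>h(A) (A - \<sigma>) h(A)\<close>, here bounded from both
    sides.\<close>
  have "\<gamma> * ((1 + a) * h) \<le> \<gamma> * (\<Sum>y\<in>V. H y * g y)"
    unfolding h_def sum_distrib_left[of "1 + a"] using \<gamma> gH by (intro mult_left_mono sum_mono) auto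
  also have "\<dots> = (\<Sum>y\<in>V. H y * (adj E H y - \<sigma> * H y))"
    by (simp add: adjH sum_distrib_left mult_ac)
  also have "\<dots> \<le> (k - \<sigma>) * h\<^sup>2 / n"
    unfolding h_def n_def using x by (intro rayleigh_shift_le max) auto
  also have "\<dots> = \<gamma> * (gk * h / n)"
    using kh by (simp add: power2_eq_square)
  finally have "(1 + a) * h \<le> gk * h / n" using \<gamma> by (simp only: mult_le_cancel_left_pos)
  then have "(1 + a) * n * h \<le> gk * h" using n by (simp add: pos_le_divide_eq mult_ac)
  then show ?thesis using h by (simp add: gk_def n_def)
qed

text \<open>On at most two vertices the only possible edge is \<open>V\<close> itself, but every
  vertex lies in \<open>r \<ge> 2\<close> edges.\<close>

lemma card_V_ge_3:
  assumes "V \<noteq> {}"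
  shows "3 \<le> card V"
proof (rule ccontr)
  assume "\<not> 3 \<le> card V"
  obtain x where x: "x \<in> V" using assms by blast
  have "e = V" if "e \<in> E" for e
    using that edge_subset card_edge u_ge_2 \<open>\<not> 3 \<le> card V\<close> finite_V
    by (intro card_seteq) auto
  then have "{e\<in>E. x \<in> e} \<subseteq> {V}" by auto
  then have "card {e\<in>E. x \<in> e} \<le> 1" using card_mono[of "{V}"] by simp
  then show False using degree[OF x] r_ge_2 by simp
qed

end

section \<open>The second eigenvalue\<close>

text \<open>Replacing the first basis vector by the all-ones vector makes \<open>A\<close> block triangular.\<close>

lemma char_poly_constant_row_sums:
  fixes A :: "'a :: field mat"
  assumes A: "A \<in> carrier_mat (Suc m) (Suc m)"
    and row: "\<And>i. i \<le> m \<Longrightarrow> (\<Sum>j\<le>m. A $$ (i, j)) = t"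
  shows "char_poly A
    = [:- t, 1:] * char_poly (mat m m (\<lambda>(i, j). A $$ (Suc i, Suc j) - A $$ (0, Suc j)))"
proof -
  define B where "B = mat m m (\<lambda>(i, j). A $$ (Suc i, Suc j) - A $$ (0, Suc j))"
  define R where "R = mat 1 m (\<lambda>(i, j). A $$ (0, Suc j))"
  define T where "T = mat 1 1 (\<lambda>_. t)"
  define C where "C = four_block_mat T R (0\<^sub>m m 1) B"
  \<comment> \<open>The first column of \<open>P\<close> is the all-ones vector and the others are
    unit vectors; \<open>P'\<close> is its inverse.\<close>
  define P where "P = mat (Suc m) (Suc m) (\<lambda>(i, j). if j = 0 \<or> i = j then 1 else 0 :: 'a)"
  define P' where "P' = mat (Suc m) (Suc m) (\<lambda>(i, j). if i = j then 1 else if j = 0 then -1 else 0 :: 'a)"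
  have carr: "B \<in> carrier_mat m m" "R \<in> carrier_mat 1 m" "T \<in> carrier_mat 1 1"
    "P \<in> carrier_mat (Suc m) (Suc m)" "P' \<in> carrier_mat (Suc m) (Suc m)"
    by (simp_all add: B_def R_def T_def P_def P'_def)
  have C: "C \<in> carrier_mat (Suc m) (Suc m)"
    using four_block_carrier_mat[OF carr(3,1), of R "0\<^sub>m m 1"] by (simp add: C_def)
  have index_mult: "(X * Y) $$ (i, j) = (\<Sum>l\<le>m. X $$ (i, l) * Y $$ (l, j))"
    if "X \<in> carrier_mat (Suc m) (Suc m)" "Y \<in> carrier_mat (Suc m) (Suc m)" "i \<le> m" "j \<le> m" for X Y :: "'a mat" and i j
    using that by (auto simp: scalar_prod_def atLeast0LessThan lessThan_Suc_atMost)
  have P: "P $$ (i, j) = of_bool (i = j) + of_bool (j = 0 \<and> i \<noteq> 0)" if "i \<le> m" "j \<le> m" for i j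
    using that by (auto simp: P_def)
  have P': "P' $$ (i, j) = of_bool (i = j) - of_bool (j = 0 \<and> i \<noteq> 0)" if "i \<le> m" "j \<le> m" for i j
    using that by (auto simp: P'_def)
  have sum_row: "(\<Sum>l\<le>m. (of_bool (i = l) + s * of_bool (l = 0 \<and> i \<noteq> 0)) * f l) = f i + (if i = 0 then 0 else s * f 0)"
    if "i \<le> m" for i s and f :: "nat \<Rightarrow> 'a"
  proof -
    have "(\<Sum>l\<le>m. (of_bool (i = l) + s * of_bool (l = 0 \<and> i \<noteq> 0)) * f l)
      = (\<Sum>l\<le>m. (if i = l then f l else 0) + (if l = 0 then if i = 0 then 0 else s * f 0 else 0))"
      by (intro sum.cong refl) auto
    then show ?thesis using that by (simp add: sum.distrib sum.delta sum.delta')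
  qed
  have PX: "(P * X) $$ (i, j) = X $$ (i, j) + (if i = 0 then 0 else X $$ (0, j))"
    if "X \<in> carrier_mat (Suc m) (Suc m)" "i \<le> m" "j \<le> m" for X i j
    using sum_row[OF that(2), of 1 "\<lambda>l. X $$ (l, j)"] that
    by (subst index_mult[OF carr(4)]) (simp_all add: P)
  have P'X: "(P' * X) $$ (i, j) = X $$ (i, j) - (if i = 0 then 0 else X $$ (0, j))"
    if "X \<in> carrier_mat (Suc m) (Suc m)" "i \<le> m" "j \<le> m" for X i j
    using sum_row[OF that(2), of "-1" "\<lambda>l. X $$ (l, j)"] that
    by (subst index_mult[OF carr(5)]) (simp_all add: P')
  have PP': "P * P' = 1\<^sub>m (Suc m)"
    using carr by (intro eq_matI) (auto simp: PX P' simp del: index_mult_mat(1))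
  have P'P: "P' * P = 1\<^sub>m (Suc m)"
    using carr by (intro eq_matI) (auto simp: P'X P simp del: index_mult_mat(1))
  have AP: "A * P = P * C"
  proof (rule eq_matI)
    fix i j assume "i < dim_row (P * C)" "j < dim_col (P * C)"
    then have ij: "i \<le> m" "j \<le> m" using carr C by auto
    have "(A * P) $$ (i, j) = (if j = 0 then t else A $$ (i, j))"
    proof (cases "j = 0")
      case True
      have "(A * P) $$ (i, j) = (\<Sum>l\<le>m. A $$ (i, l))"
        unfolding index_mult[OF A carr(4) ij] using True by (intro sum.cong refl) (simp add: P)
      then show ?thesis using row ij True by simp
    next
      case False
      have "(A * P) $$ (i, j) = (\<Sum>l\<le>m. if j = l then A $$ (i, l) else 0)"
        unfolding index_mult[OF A carr(4) ij] using False ij by (intro sum.cong refl) (simp add: P)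
      then show ?thesis using ij False by (simp add: sum.delta')
    qed
    also have "\<dots> = (P * C) $$ (i, j)"
      unfolding PX[OF C ij] using ij by (cases i; cases j) (auto simp: C_def T_def R_def B_def)
    finally show "(A * P) $$ (i, j) = (P * C) $$ (i, j)" .
  qed (use A carr C in auto)
  have "A = A * (P * P')" using A by (simp add: PP')
  also have "\<dots> = P * C * P'" using A carr AP by (simp flip: assoc_mult_mat[of A _ _ P _ P'])
  finally have "similar_mat A C"
    using A C carr PP' P'P by (intro similar_matI[of _ _ P P' "Suc m"]) auto
  then have "char_poly A = char_poly T * char_poly B"
    using char_poly_four_block_zeros_col[OF carr(3,2,1)] by (simp add: char_poly_similar C_def)
  also have "char_poly T = [:- t, 1:]"
    by (simp add: char_poly_def char_poly_matrix_def T_def det_single one_mat_def)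
  finally show ?thesis by (simp add: B_def)
qed

lemma second_largest_add_mset:
  fixes t \<mu> :: "'a :: linorder"
  assumes "\<mu> \<in># M" "\<mu> \<le> t" "\<And>x. x \<in># M \<Longrightarrow> x \<le> \<mu>"
  shows "rev (sorted_list_of_multiset (add_mset t M)) ! 1 = \<mu>"
proof -
  define xs where "xs = sorted_list_of_multiset (M - {#\<mu>#})"
  have xs: "sorted xs" "mset xs = M - {#\<mu>#}" by (simp_all add: xs_def)
  have "set xs \<subseteq> set_mset M" by (metis in_diffD set_mset_mset subsetI xs(2))
  then have "sorted (xs @ [\<mu>, t])" using xs assms by (auto simp: sorted_append intro: order_trans)
  moreover have "mset (xs @ [\<mu>, t]) = add_mset t M" using xs assms by simp
  ultimately have "sorted_list_of_multiset (add_mset t M) = xs @ [\<mu>, t]"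
    by (metis sorted_list_of_multiset_mset sorted_sort_id)
  then show ?thesis by simp
qed

context regular_uniform_hypergraph begin

lemma vertex_list: "distinct (vertex_list V)" "set (vertex_list V) = V" "length (vertex_list V) = card V"
proof -
  have "\<exists>xs. distinct xs \<and> set xs = V" using finite_distinct_list[OF finite_V] by blast
  then have "distinct (vertex_list V) \<and> set (vertex_list V) = V"
    unfolding vertex_list_def by (rule someI_ex)
  then show "distinct (vertex_list V)" "set (vertex_list V) = V" "length (vertex_list V) = card V"
    using distinct_card[of "vertex_list V"] by auto
qed

text \<open>The factor \<open>B\<close> of the characteristic polynomial is \<open>A\<close> acting
  modulo constants, in the coordinates \<open>f (x (Suc i)) - f (x 0)\<close>. Its eigenvectors lift
  to mean-zero eigenvectors of \<open>A\<close>, so \<open>\<mu>\<close> is its largest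
  eigenvalue.\<close>

lemma second_eigenvalue_max_rayleigh:
  assumes card: "2 \<le> card V"
    and eig: "\<And>y. y \<in> V \<Longrightarrow> adj E v y = \<mu> * v y" and mean: "(\<Sum>y\<in>V. v y) = 0" and nz: "\<exists>y\<in>V. v y \<noteq> 0"
    and max: "\<And>w. (\<Sum>y\<in>V. w y) = 0 \<Longrightarrow> rayleigh w \<le> \<mu> * (\<Sum>y\<in>V. (w y)\<^sup>2)"
  shows "second_eigenvalue V E = \<mu>"
proof -
  obtain m where m: "card V = Suc m" using card by (cases "card V") auto
  define x where "x = (\<lambda>i. vertex_list V ! i)"
  define A where "A = adjacency_matrix V E"
  define B where "B = mat m m (\<lambda>(i, j). A $$ (Suc i, Suc j) - A $$ (0, Suc j))"
  have bij: "bij_betw x {..m} V"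
    unfolding x_def using vertex_list m by (auto intro!: bij_betw_nth)
  have xV: "x i \<in> V" if "i \<le> m" for i using bij that by (auto simp: bij_betw_def)
  have sum_V: "(\<Sum>y\<in>V. f y) = (\<Sum>i\<le>m. f (x i))" for f :: "'a \<Rightarrow> real"
    by (rule sum.reindex_bij_betw[OF bij, symmetric])
  have sum_V': "(\<Sum>y\<in>V. f y) = f (x 0) + (\<Sum>i<m. f (x (Suc i)))" for f :: "'a \<Rightarrow> real"
    unfolding sum_V by (rule sum.atMost_shift)
  have A_carr: "A \<in> carrier_mat (Suc m) (Suc m)" and B_carr: "B \<in> carrier_mat m m"
    by (simp_all add: A_def B_def adjacency_matrix_def m)
  have A: "A $$ (i, j) = adjacency E (x i) (x j)" if "i \<le> m" "j \<le> m" for i j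
    using that by (simp add: A_def adjacency_matrix_def m x_def)
  have adj_A: "adj E f (x i) = A $$ (i, 0) * f (x 0) + (\<Sum>j<m. A $$ (i, Suc j) * f (x (Suc j)))" if "i \<le> m" for f i
    using that by (simp add: adj_adjacency xV sum_V' A)
  have row: "(\<Sum>j\<le>m. A $$ (i, j)) = k" if "i \<le> m" for i
    using adj_A[OF that, of "\<lambda>_. 1"] adj_const[OF xV[OF that], of 1] by (simp add: sum.atMost_shift)
  have char_A: "char_poly A = [:- k, 1:] * char_poly B"
    unfolding B_def by (rule char_poly_constant_row_sums[OF A_carr row])
  have B_index: "(B *\<^sub>v w) $ i = (\<Sum>j<m. (A $$ (Suc i, Suc j) - A $$ (0, Suc j)) * w $ j)"
    if "i < m" "w \<in> carrier_vec m" for w i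
    using that by (simp add: B_def scalar_prod_def atLeast0LessThan)
  have B_diff: "(\<Sum>j<m. (A $$ (Suc i, Suc j) - A $$ (0, Suc j)) * (f (x (Suc j)) - f (x 0)))
      = adj E f (x (Suc i)) - adj E f (x 0)" if "i < m" for f i
  proof -
    \<comment> \<open>Subtracting a constant changes \<open>adj\<close> by the same amount at every
      vertex, and \<open>g (x 0) = 0\<close> removes column 0.\<close>
    define g where "g = (\<lambda>y. f y + - f (x 0) * 1)"
    have g0: "g (x 0) = 0" by (simp add: g_def)
    have i: "Suc i \<le> m" using that by simp
    have "(\<Sum>j<m. (A $$ (Suc i, Suc j) - A $$ (0, Suc j)) * (f (x (Suc j)) - f (x 0)))
      = (\<Sum>j<m. A $$ (Suc i, Suc j) * g (x (Suc j)) - A $$ (0, Suc j) * g (x (Suc j)))"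
      by (intro sum.cong refl) (simp add: g_def algebra_simps)
    also have "\<dots> = adj E g (x (Suc i)) - adj E g (x 0)"
      unfolding sum_subtractf adj_A[OF i] adj_A[OF le0] g0 by simp
    also have "\<dots> = adj E f (x (Suc i)) - adj E f (x 0)"
      unfolding g_def adj_add by (simp add: adj_const xV i)
    finally show ?thesis .
  qed
  have "eigenvalue B \<mu>"
  proof -
    define w where "w = vec m (\<lambda>i. v (x (Suc i)) - v (x 0))"
    have "w \<noteq> 0\<^sub>v m"
    proof
      assume "w = 0\<^sub>v m"
      then have "v (x (Suc i)) = v (x 0)" if "i < m" for i
        using that by (metis eq_iff_diff_eq_0 index_vec index_zero_vec(1) w_def)
      then have const: "v (x i) = v (x 0)" if "i \<le> m" for i using that by (cases i) auto
      then have "(\<Sum>i\<le>m. v (x i)) = (\<Sum>i\<le>m. v (x 0))" by (intro sum.cong refl const) auto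
      then have "real (Suc m) * v (x 0) = 0" using mean unfolding sum_V by simp
      then have "v (x 0) = 0" by simp
      with const have "v y = 0" if "y \<in> V" for y using that bij by (auto simp: bij_betw_def)
      with nz show False by blast
    qed
    moreover have "B *\<^sub>v w = \<mu> \<cdot>\<^sub>v w"
    proof (rule eq_vecI)
      fix i assume "i < dim_vec (\<mu> \<cdot>\<^sub>v w)"
      then have i: "i < m" by (simp add: w_def)
      have "(B *\<^sub>v w) $ i = (\<Sum>j<m. (A $$ (Suc i, Suc j) - A $$ (0, Suc j)) * (v (x (Suc j)) - v (x 0)))"
        using i by (simp add: B_index w_def)
      also have "\<dots> = \<mu> * (v (x (Suc i)) - v (x 0))"
        using i unfolding B_diff[OF i] by (simp add: eig xV right_diff_distrib)
      finally show "(B *\<^sub>v w) $ i = (\<mu> \<cdot>\<^sub>v w) $ i" using i by (simp add: w_def)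
    qed (simp add: B_def w_def)
    ultimately have "eigenvector B w \<mu>" using B_carr by (simp add: eigenvector_def w_def)
    then show ?thesis by (auto simp: eigenvalue_def)
  qed
  moreover have "\<nu> \<le> \<mu>" if "eigenvalue B \<nu>" for \<nu>
  proof -
    obtain w where w: "w \<in> carrier_vec m" "w \<noteq> 0\<^sub>v m" "B *\<^sub>v w = \<nu> \<cdot>\<^sub>v w"
      using \<open>eigenvalue B \<nu>\<close> B_carr by (auto simp: eigenvalue_def eigenvector_def)
    \<comment> \<open>The lift of \<open>w\<close> normalized to vanish at \<open>x 0\<close>;
      subtracting its mean \<open>t\<close> below makes it mean-zero.\<close>
    define f where "f y = (case the_inv_into {..m} x y of 0 \<Rightarrow> 0 | Suc i \<Rightarrow> w $ i)" for y
    have inv: "the_inv_into {..m} x (x i) = i" if "i \<le> m" for i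
      using bij that by (auto simp: bij_betw_def the_inv_into_f_f)
    have f0: "f (x 0) = 0" and f_Suc: "\<And>i. i < m \<Longrightarrow> f (x (Suc i)) = w $ i"
      by (simp_all add: f_def inv)
    define n where "n = real (card V)"
    have n: "0 < n" using card by (simp add: n_def)
    define t where "t = (\<Sum>y\<in>V. f y) / n"
    define g where "g y = f y + - t * 1" for y
    have mean_g: "(\<Sum>y\<in>V. g y) = 0" using n by (simp add: g_def sum_subtractf t_def n_def)
    have adj_f: "adj E f y = \<nu> * f y + adj E f (x 0)" if "y \<in> V" for y
    proof -
      have "y \<in> x ` {..m}" using that bij_betw_imp_surj_on[OF bij] by simp
      then obtain i where i: "i \<le> m" "y = x i" by auto
      show ?thesis
      proof (cases i)
        case 0
        then show ?thesis using i f0 by simp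
      next
        case (Suc j)
        then have j: "j < m" using i by simp
        have "adj E f (x (Suc j)) - adj E f (x 0) = (B *\<^sub>v w) $ j"
          unfolding B_index[OF j w(1)] using B_diff[OF j, of f] by (simp add: f0 f_Suc)
        then show ?thesis using i Suc j w by (simp add: f_Suc)
      qed
    qed
    \<comment> \<open>The leftover constant in the eigenvalue equation for \<open>g\<close>. It
      vanishes because \<open>adj E g\<close> has mean zero.\<close>
    define s where "s = adj E f (x 0) + (\<nu> - k) * t"
    have adj_g: "adj E g y = \<nu> * g y + s" if "y \<in> V" for y
    proof -
      have "adj E g y = adj E f y - t * k" unfolding g_def adj_add using that by (simp add: adj_const)
      then show ?thesis unfolding adj_f[OF that] by (simp add: g_def s_def algebra_simps)
    qed
    have "n * s = 0"
      using sum_adj[of g] by (simp add: adj_g sum.distrib mean_g n_def flip: sum_distrib_left)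
    then have s: "s = 0" using n by simp
    have "\<exists>y\<in>V. g y \<noteq> 0"
    proof (rule ccontr)
      assume "\<not> ?thesis"
      then have g: "g (x i) = 0" if "i \<le> m" for i using xV[OF that] by blast
      from g[of 0] have "t = 0" by (simp add: g_def f0)
      then have "w $ i = 0" if "i < m" for i
        using that g[of "Suc i"] by (simp add: g_def f_Suc)
      then have "w = 0\<^sub>v m" using w(1) by (intro eq_vecI) auto
      with w(2) show False ..
    qed
    then obtain y where "y \<in> V" "g y \<noteq> 0" by blast
    then have pos: "0 < (\<Sum>y\<in>V. (g y)\<^sup>2)" using finite_V by (intro sum_pos2[of _ y]) auto
    have "rayleigh g = \<nu> * (\<Sum>y\<in>V. (g y)\<^sup>2)"
      unfolding rayleigh_def sum_distrib_left by (intro sum.cong refl) (simp add: adj_g s power2_eq_square)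
    with max[OF mean_g] pos show ?thesis by simp
  qed
  moreover have "\<mu> \<le> k"
    using abs_F_eigenvalue_le[OF eig nz, of "Suc 0"] by simp
  moreover have "char_poly B \<noteq> 0" using degree_monic_char_poly[OF B_carr] by auto
  moreover have "proots (char_poly A) = add_mset k (proots (char_poly B))"
    unfolding char_A using \<open>char_poly B \<noteq> 0\<close> by (subst proots_mult) auto
  ultimately show ?thesis
    unfolding second_eigenvalue_def eigenvalues_mset_def A_def[symmetric]
    using second_largest_add_mset[of \<mu> "proots (char_poly B)" k]
    by (simp add: eigenvalue_root_char_poly[OF B_carr])
qed

end

section \<open>Assembly of the bounds in the three ranges of \<open>\<tau>\<close>\<close>

theorem theorem6p11:
  fixes V :: "'a set" and E :: "'a set set" and r u d n :: nat and k q \<tau> c :: real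
  assumes "2 \<le> r" and "2 \<le> u"
    and k: "k = real r * (real u - 1)"
    and q: "q = (real r - 1) * (real u - 1)"
    and "hypergraph V E" and "connected_hypergraph V E"
    and "regular V E r" and "uniform E u"
    and "3 \<le> girth V E"
    and "diameter V E = enat d" and "1 \<le> d"
    and n: "n = card V"
    and tau: "\<tau> = second_eigenvalue V E"
    and c: "c = - poly (F r u d) \<tau> / poly (G r u (d - 1)) \<tau>"
  shows
    "(lam r u d \<le> ereal \<tau> \<longrightarrow>
        real n \<le> poly (G r u d) k - poly (G r u d) \<tau> \<and> 0 \<le> poly (G r u d) \<tau>) \<and>
     (lam r u (d - 1) < ereal \<tau> \<and> ereal \<tau> < lam r u d \<longrightarrow>
        real n \<le> 1 + (\<Sum>j<d - 1. k * q ^ j) + k * q ^ (d - 1) / c \<and>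
        1 + (\<Sum>j<d - 1. k * q ^ j) + k * q ^ (d - 1) / c
          \<le> poly (G r u d) k + poly (G r u d) \<tau> \<and>
        poly (G r u d) \<tau> < 0) \<and>
     (ereal \<tau> \<le> lam r u (d - 1) \<longrightarrow>
        real n \<le> 1 + (\<Sum>j<d - 1. k * q ^ j)) \<and>
     (lam r u (d - 1) < ereal \<tau> \<and> ereal \<tau> < lam r u d \<and> 6 \<le> q \<longrightarrow>
        1 + (\<Sum>j<d - 1. k * q ^ j) + k * q ^ (d - 1) / c
          < poly (G r u d) k + poly (G r u d) \<tau>)"
proof -
  interpret H: regular_uniform_hypergraph r u V E
    using assms by unfold_locales (auto simp: hypergraph_def regular_def uniform_def)
  have kq: "H.k = k" "H.q = q" by (simp_all add: H.k_def H.q_def k q)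
  obtain i where d: "d = Suc i" using \<open>1 \<le> d\<close> by (cases d) auto
  \<comment> \<open>The supremum over an empty vertex set is 0, contrary to
    \<open>1 \<le> d\<close>.\<close>
  have "V \<noteq> {}"
  proof
    assume "V = {}"
    then have "diameter V E = bot" by (simp add: diameter_def)
    then show False using \<open>diameter V E = enat d\<close> d by (simp add: bot_enat_def enat_0_iff)
  qed
  then obtain x where x: "x \<in> V" by blast
  have n3: "3 \<le> card V" by (rule H.card_V_ge_3) fact
  obtain v where eig: "\<And>y. y \<in> V \<Longrightarrow> adj E v y = \<tau> * v y" and mean: "(\<Sum>y\<in>V. v y) = 0"
    and nz: "\<exists>y\<in>V. v y \<noteq> 0"
    and max: "\<And>w. (\<Sum>y\<in>V. w y) = 0 \<Longrightarrow> H.rayleigh w \<le> \<tau> * (\<Sum>y\<in>V. (w y)\<^sup>2)"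
  proof (rule H.exists_max_rayleigh)
    show "2 \<le> card V" using n3 by simp
    fix v \<mu>
    assume *: "\<And>y. y \<in> V \<Longrightarrow> adj E v y = \<mu> * v y" "(\<Sum>y\<in>V. v y) = 0" "\<exists>y\<in>V. v y \<noteq> 0"
      "\<And>w. (\<Sum>y\<in>V. w y) = 0 \<Longrightarrow> H.rayleigh w \<le> \<mu> * (\<Sum>y\<in>V. (w y)\<^sup>2)"
    have "\<mu> = \<tau>"
      unfolding tau using n3 * by (intro H.second_eigenvalue_max_rayleigh[symmetric]) auto
    then show thesis using that[of v] * by simp
  qed
  define g where "g = poly (G r u i) \<tau>"
  define f where "f = - poly (F r u d) \<tau>"
  have G_k: "1 + (\<Sum>j<d - 1. k * q ^ j) = poly (G r u i) k" "poly (G r u d) k = poly (G r u i) k + k * q ^ i"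
    using H.G_at_k[of i] H.G_at_k[of d] by (simp_all add: kq d)
  have G_tau: "poly (G r u d) \<tau> = g - f" by (simp add: g_def f_def d H.G_Suc)
  have c: "c = f / g" by (simp add: c f_def g_def d)
  have bound_i: "\<bar>poly (G r u d) \<tau>\<bar> \<le> poly (G r u d) k - real n"
    unfolding n kq(1)[symmetric]
    by (rule H.abs_G_eigenvalue_le[OF eig nz mean H.nbw_upto_diameter]) (use assms in auto)
  have f_le: "f \<le> k * q ^ i"
    using H.abs_F_eigenvalue_le[OF eig nz, of d] by (simp add: f_def d kq H.F_at_k[unfolded kq])
  have part_i: "real n \<le> poly (G r u d) k - poly (G r u d) \<tau> \<and> 0 \<le> poly (G r u d) \<tau>"
    if "lam r u d \<le> ereal \<tau>"
    using H.G_nonneg_of_lam[OF that] bound_i by simp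
  have part_iii: "real n \<le> poly (G r u i) k" if tau_le: "ereal \<tau> \<le> lam r u i"
  proof -
    \<comment> \<open>\<open>lam r u 0\<close> is minus infinity, so \<open>i\<close> is positive
      here.\<close>
    obtain j where j: "i = Suc j" using tau_le by (cases i) (auto simp: lam_def)
    define \<sigma> where "\<sigma> = largest_zero (G r u i)"
    have "\<tau> \<le> \<sigma>" using tau_le by (simp add: lam_def j \<sigma>_def)
    then have max': "H.rayleigh w \<le> \<sigma> * (\<Sum>y\<in>V. (w y)\<^sup>2)" if "(\<Sum>y\<in>V. w y) = 0" for w
      using max[OF that] by (meson mult_right_mono order_trans sum_nonneg zero_le_power2)
    show ?thesis
      using H.linear_programming_bound[OF max' x, of j 0] H.largest_zero_G[of j]
      by (simp add: \<sigma>_def j kq n)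
  qed
  have part_ii: "real n \<le> poly (G r u i) k + k * q ^ i / c" "poly (G r u d) \<tau> < 0" "0 < g"
    if lam: "lam r u i < ereal \<tau>" "ereal \<tau> < lam r u d"
  proof -
    show g: "0 < g" unfolding g_def using H.G_pos_of_lam[OF lam(1)] by simp
    show neg: "poly (G r u d) \<tau> < 0"
      unfolding d by (rule H.G_neg_between) (use lam d in auto)
    have c1: "1 < c" using g neg by (simp add: c G_tau)
    \<comment> \<open>The choice \<open>a = c - 1\<close> is the one that makes
      \<open>\<tau>\<close> a zero of \<open>G_d + a G_(d-1)\<close>.\<close>
    have "(1 + (c - 1)) * real (card V) \<le> poly (G r u (Suc i)) H.k + (c - 1) * poly (G r u i) H.k"
    proof (rule H.linear_programming_bound[OF max x])
      show "poly (G r u (Suc i)) \<tau> = - (c - 1) * poly (G r u i) \<tau>"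
        using G_tau g unfolding d g_def[symmetric] by (simp add: c left_diff_distrib)
    qed (use H.G_pos_of_lam[OF lam(1)] c1 in auto)
    then have "c * real n \<le> c * poly (G r u i) k + k * q ^ i"
      using G_k(2) by (simp add: kq d n algebra_simps)
    then show "real n \<le> poly (G r u i) k + k * q ^ i / c"
      using c1 by (simp add: field_simps)
  qed
  \<comment> \<open>The difference of the two upper bounds factors, leaving only the comparison of
    \<open>f\<close> with \<open>k * q ^ i = F_d(k)\<close>.\<close>
  have gap: "poly (G r u d) k + poly (G r u d) \<tau> - (poly (G r u i) k + k * q ^ i / c)
      = (f - g) * (k * q ^ i - f) / f" if "0 < g" "g < f"
    using that by (simp add: G_k G_tau c field_simps)
  have part_ii_le: "poly (G r u i) k + k * q ^ i / c \<le> poly (G r u d) k + poly (G r u d) \<tau>"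
    if lam: "lam r u i < ereal \<tau>" "ereal \<tau> < lam r u d"
  proof -
    have fg: "0 < g" "g < f" using part_ii(2,3)[OF lam] by (simp_all add: G_tau)
    then have "0 \<le> (f - g) * (k * q ^ i - f) / f" using f_le by simp
    then show ?thesis using gap[OF fg] by linarith
  qed
  have part_strict: "poly (G r u i) k + k * q ^ i / c < poly (G r u d) k + poly (G r u d) \<tau>"
    if lam: "lam r u i < ereal \<tau>" "ereal \<tau> < lam r u d" and q6: "6 \<le> q"
  proof -
    have fg: "0 < g" "g < f" using part_ii(2,3)[OF lam] by (simp_all add: G_tau)
    have "f < k * q ^ i"
    proof (cases i)
      case 0
      \<comment> \<open>For \<open>d = 1\<close>, \<open>g = 1\<close> and \<open>c = f\<close>;
        equality \<open>f = k\<close> would give \<open>n \<le> 2\<close>.\<close>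
      then have "real n \<le> 1 + k / f" using part_ii(1)[OF lam] fg by (simp add: c H.G_0 g_def)
      then have "k \<noteq> f" using n3 fg by (auto simp: n)
      then show ?thesis using f_le 0 by simp
    next
      case (Suc j)
      then show ?thesis using H.minus_F_less[of j \<tau>] lam q6 by (simp only: f_def d kq)
    qed
    then have "0 < (f - g) * (k * q ^ i - f) / f" using fg by simp
    then show ?thesis using gap[OF fg] by linarith
  qed
  show ?thesis
    unfolding G_k(1) using part_i part_ii part_ii_le part_iii part_strict by (simp add: d)
qed

end
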